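(* Let $M\in\mathbb{R}$, $M\ge2$, let $a\in L^\infty(0,1)$ and $\widehat\nu<0$. Let $\psi\in\mathcal H_{0,M}$ be a weak solution to $$-(r^{M-1}\psi')'-r^{M-1}a\,\psi=r^{M-3}\,\widehat\nu\,\psi\quad\text{for }r\in(0,1),$$ that is, $\int_0^1r^{M-1}(\psi'\varphi'-a\psi\varphi)\,dr=\widehat\nu\int_0^1r^{M-3}\psi\varphi\,dr$ for every $\varphi\in\mathcal H_{0,M}$. Then $\psi\in C[0,1]\cap C^1(0,1]$ and, letting $$\theta=\frac{2-M+\sqrt{(M-2)^2-4\widehat\nu}}{2},$$ it satisfies $$\psi(r)=O(r^\theta)\quad\text{and}\quad\psi'(r)=O(r^{\theta-1})\qquad\text{as }r\to0.$$
   Context: $L^2_M$ is the set of measurable $v:(0,1)\to\mathbb{R}$ with $\int_0^1r^{M-1}v^2dr<\infty$; $H^1_M$ is the set of $v\in L^2_M$ having a first order weak derivative $v'\in L^2_M$ (every such $v$ is identified with its representative continuous on $(0,1]$); $H^1_{0,M}=\{v\in H^1_M:v(1)=0\}$; $\mathcal L_M$ is the set of measurable $v$ on $(0,1)$ with $\int_0^1r^{M-3}v^2dr<\infty$; $\mathcal H_{0,M}=H^1_{0,M}\cap\mathcal L_M$. *)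

theory Defs
  imports "HOL-Analysis.Analysis" "HOL-Library.Landau_Symbols"
begin

abbreviation unit_interval_measure :: "real measure" where
  "unit_interval_measure \<equiv> lebesgue_on {0<..<1}"

text \<open>The space of smooth functions with compact support in (0,1), each extended by zero to
  the real line.\<close>

definition test_functions :: "(real \<Rightarrow> real) set" where
  "test_functions = {\<phi>. (\<forall>k x. (deriv ^^ k) \<phi> differentiable at x) \<and>
     (\<exists>a b. 0 < a \<and> a < b \<and> b < 1 \<and> (\<forall>x. x \<notin> {a..b} \<longrightarrow> \<phi> x = 0))}"

definition locally_integrable :: "(real \<Rightarrow> real) set" where
  "locally_integrable = {v. \<forall>a b. 0 < a \<longrightarrow> a < b \<longrightarrow> b < 1 \<longrightarrow> set_integrable lebesgue {a..b} v}"

definition has_weak_derivative :: "(real \<Rightarrow> real) \<Rightarrow> (real \<Rightarrow> real) \<Rightarrow> bool" where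
  "has_weak_derivative v w \<longleftrightarrow> v \<in> locally_integrable \<and> w \<in> locally_integrable \<and>
     (\<forall>\<eta>\<in>test_functions.
        (LINT r|unit_interval_measure. v r * deriv \<eta> r) =
        - (LINT r|unit_interval_measure. w r * \<eta> r))"

definition Linfinity :: "(real \<Rightarrow> real) set" where
  "Linfinity = {a \<in> borel_measurable unit_interval_measure.
     \<exists>C. AE r in unit_interval_measure. \<bar>a r\<bar> \<le> C}"

definition L2 :: "real \<Rightarrow> (real \<Rightarrow> real) set" where
  "L2 M = {v \<in> borel_measurable unit_interval_measure.
     integrable unit_interval_measure (\<lambda>r. r powr (M - 1) * (v r)\<^sup>2)}"

text \<open>Elements of the Sobolev space are identified with their representative that is continuous
  on (0,1], so that the value at 1 makes sense; values outside (0,1] are irrelevant.\<close>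

definition H1 :: "real \<Rightarrow> (real \<Rightarrow> real) set" where
  "H1 M = {v \<in> L2 M. continuous_on {0<..1} v \<and> (\<exists>w\<in>L2 M. has_weak_derivative v w)}"

definition H1_0 :: "real \<Rightarrow> (real \<Rightarrow> real) set" where
  "H1_0 M = {v \<in> H1 M. v 1 = 0}"

definition L_Hardy :: "real \<Rightarrow> (real \<Rightarrow> real) set" where
  "L_Hardy M = {v \<in> borel_measurable unit_interval_measure.
     integrable unit_interval_measure (\<lambda>r. r powr (M - 3) * (v r)\<^sup>2)}"

definition H_0 :: "real \<Rightarrow> (real \<Rightarrow> real) set" where
  "H_0 M = H1_0 M \<inter> L_Hardy M"

text \<open>A weak derivative is unique only up to null sets, and the integrals do not depend on the
  version; hence the identity is required for all versions of the weak derivatives.\<close>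

definition weak_solution ::
  "real \<Rightarrow> (real \<Rightarrow> real) \<Rightarrow> real \<Rightarrow> (real \<Rightarrow> real) \<Rightarrow> bool" where
  "weak_solution M a \<nu> \<psi> \<longleftrightarrow> \<psi> \<in> H_0 M \<and>
     (\<forall>\<psi>' \<phi> \<phi>'. has_weak_derivative \<psi> \<psi>' \<longrightarrow> \<phi> \<in> H_0 M \<longrightarrow> has_weak_derivative \<phi> \<phi>' \<longrightarrow>
        (LINT r|unit_interval_measure. r powr (M - 1) * (\<psi>' r * \<phi>' r - a r * \<psi> r * \<phi> r)) =
        \<nu> * (LINT r|unit_interval_measure. r powr (M - 3) * \<psi> r * \<phi> r))"

end

theory Submission
  imports Defs
begin

text \<open>
  Testing the weak formulation with a primitive of the deviation of
  \<open>r\<^bsup>M-1\<^esup> \<psi>' + \<integral> (r\<^bsup>M-1\<^esup> a \<psi> + \<nu> r\<^bsup>M-3\<^esup> \<psi>)\<close> from its mean shows that this function is constant, so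
  \<open>\<psi>\<close> is \<open>C\<^sup>1\<close> on \<open>(0,1]\<close> and its flux is absolutely continuous. With \<open>\<kappa> = \<theta> + M - 2\<close> and
  \<open>D = r d/dr\<close> the equation factors as \<open>(D - \<theta>) (D + \<kappa>) \<psi> = - r\<^sup>2 a \<psi>\<close>, which gives
  \<open>(r\<^bsup>\<kappa>\<^esup> (D \<psi> - \<theta> \<psi>))' = - r\<^bsup>\<kappa>+1\<^esup> a \<psi>\<close> and \<open>(r\<^bsup>-\<theta>\<^esup> (D \<psi> + \<kappa> \<psi>))' = - r\<^bsup>1-\<theta>\<^esup> a \<psi>\<close>. Finite energy forces
  \<open>\<psi> = O(r\<^bsup>-(M-2)/2\<^esup>)\<close> and makes \<open>r\<^bsup>\<kappa>\<^esup> (D \<psi> - \<theta> \<psi>)\<close> vanish along a sequence tending to \<open>0\<close>, which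
  excludes the singular solution \<open>r\<^bsup>-\<kappa>\<^esup>\<close>. Integrating the first identity from \<open>0\<close> and the second from
  \<open>1\<close> improves a bound \<open>\<psi> = O(r\<^bsup>\<sigma>\<^esup>)\<close> to \<open>\<psi>, D \<psi> = O(r\<^bsup>min \<theta> (\<sigma>+1)\<^esup>)\<close>, and this is iterated until the
  exponent is \<open>\<theta>\<close>.
\<close>

section \<open>Absolutely continuous functions\<close>

text \<open>The two segments differ by one point. Both forms occur because the diagonal of the
  square can belong to only one of the two triangles in the Fubini argument.\<close>

lemma lebesgue_integral_initial_segment:
  fixes g :: "real \<Rightarrow> real"
  assumes g: "g absolutely_integrable_on {a..b}" and x: "a \<le> x" "x \<le> b"
  shows "(LINT y|lebesgue_on {a..b}. indicator {..x} y * g y) = integral {a..x} g"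
    and "(LINT y|lebesgue_on {a..b}. indicator {..<x} y * g y) = integral {a..x} g"
proof -
  have gx: "g absolutely_integrable_on {a..x}" 
    using absolutely_integrable_on_subinterval[OF g] x by auto
  then have gx': "g absolutely_integrable_on {a..<x}"
    by (rule absolutely_integrable_spike_set) (auto intro: negligible_subset[of "{x}"])
  have "(LINT y|lebesgue_on {a..b}. indicator {..x} y * g y) = (LINT y:{a..x}|lebesgue. g y)"
    unfolding set_lebesgue_integral_def using x
    by (subst integral_restrict_space) (auto intro!: Bochner_Integration.integral_cong simp: indicator_def)
  also have "\<dots> = integral {a..x} g"
    by (rule set_lebesgue_integral_eq_integral[OF gx])
  finally show "(LINT y|lebesgue_on {a..b}. indicator {..x} y * g y) = integral {a..x} g" .
  have "(LINT y|lebesgue_on {a..b}. indicator {..<x} y * g y) = (LINT y:{a..<x}|lebesgue. g y)"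
    unfolding set_lebesgue_integral_def using x
    by (subst integral_restrict_space) (auto intro!: Bochner_Integration.integral_cong simp: indicator_def)
  also have "\<dots> = integral {a..<x} g"
    by (rule set_lebesgue_integral_eq_integral[OF gx'])
  also have "\<dots> = integral {a..x} g"
    by (rule integral_spike_set) (auto intro: negligible_subset[of "{x}"])
  finally show "(LINT y|lebesgue_on {a..b}. indicator {..<x} y * g y) = integral {a..x} g" .
qed

lemma continuous_mult_absolutely_integrable:
  fixes f g :: "real \<Rightarrow> real"
  assumes "continuous_on {a..b} f" "g absolutely_integrable_on {a..b}"
  shows "(\<lambda>x. f x * g x) absolutely_integrable_on {a..b}"
proof (rule absolutely_integrable_bounded_measurable_product_real)
  show "f \<in> borel_measurable (lebesgue_on {a..b})"
    by (intro continuous_imp_measurable_on_sets_lebesgue assms) auto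
  show "bounded (f ` {a..b})"
    using assms(1) compact_continuous_image compact_imp_bounded by blast
qed (use assms in auto)

text \<open>Fubini on the square, split along the diagonal.\<close>

lemma integral_mult_primitives:
  fixes f g :: "real \<Rightarrow> real"
  assumes f: "f absolutely_integrable_on {a..b}" and g: "g absolutely_integrable_on {a..b}"
  shows "integral {a..b} (\<lambda>x. f x * integral {a..x} g) + integral {a..b} (\<lambda>x. integral {a..x} f * g x)
       = integral {a..b} f * integral {a..b} g"
proof -
  let ?M = "lebesgue_on {a..b}"
  interpret finite_measure ?M
    by (rule finite_measure_lebesgue_on) auto
  interpret pair_sigma_finite ?M ?M ..
  have fi : "integrable ?M f" and gi: "integrable ?M g"
    using f g by (auto intro: absolutely_integrable_imp_integrable)
  have [measurable]: "f \<in> borel_measurable ?M" "g \<in> borel_measurable ?M"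
    using fi gi by auto
  have id [measurable]: "(\<lambda>x. x) \<in> ?M \<rightarrow>\<^sub>M borel"
    by (simp add: measurable_restrict_space1 measurable_completion)
  have fg: "integrable (?M \<Otimes>\<^sub>M ?M) (\<lambda>(x, y). f x * g y)"
    by (rule Fubini_integrable) (use fi gi in \<open>auto simp: abs_mult\<close>)
  have cont: "continuous_on {a..b} (\<lambda>x. integral {a..x} f)" "continuous_on {a..b} (\<lambda>x. integral {a..x} g)"
    using f g by (auto intro!: indefinite_integral_continuous_1 set_lebesgue_integral_eq_integral(1))
  have ai: "(\<lambda>x. f x * integral {a..x} g) absolutely_integrable_on {a..b}"
     "(\<lambda>x. integral {a..x} f * g x) absolutely_integrable_on {a..b}"
    using continuous_mult_absolutely_integrable[OF cont(1) g] continuous_mult_absolutely_integrable[OF cont(2) f] 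
    by (simp_all add: mult.commute)
  \<comment> \<open>The diagonal is put into \<open>?D\<close> only, so the two kernels add up to
    \<open>f x * g y\<close> at every point, and each is dominated by that integrable
    product.\<close>
  let ?D = "\<lambda>x y. indicator {..x} y * (f x * g y) :: real"
  let ?U = "\<lambda>x y. indicator {..<y} x * (f x * g y) :: real"
  have D: "integrable (?M \<Otimes>\<^sub>M ?M) (case_prod ?D)"
    by (rule Bochner_Integration.integrable_bound[OF fg]) (auto simp: indicator_def)
  have U: "integrable (?M \<Otimes>\<^sub>M ?M) (case_prod ?U)"
    by (rule Bochner_Integration.integrable_bound[OF fg]) (auto simp: indicator_def)
  have "(\<integral>x. \<integral>y. f x * g y \<partial>?M \<partial>?M) = integral\<^sup>L (?M \<Otimes>\<^sub>M ?M) (\<lambda>(x, y). f x * g y)"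
    using integral_fst[OF fg] by simp
  also have "\<dots> = integral\<^sup>L (?M \<Otimes>\<^sub>M ?M) (\<lambda>p. case_prod ?D p + case_prod ?U p)"
    by (intro Bochner_Integration.integral_cong) (auto simp: indicator_def)
  also have "\<dots> = integral\<^sup>L (?M \<Otimes>\<^sub>M ?M) (case_prod ?D) + integral\<^sup>L (?M \<Otimes>\<^sub>M ?M) (case_prod ?U)"
    by (rule Bochner_Integration.integral_add[OF D U])
  also have "integral\<^sup>L (?M \<Otimes>\<^sub>M ?M) (case_prod ?D) = (\<integral>x. \<integral>y. ?D x y \<partial>?M \<partial>?M)"
    using integral_fst[OF D] by simp
  also have "\<dots> = (\<integral>x. f x * integral {a..x} g \<partial>?M)"
  proof (rule Bochner_Integration.integral_cong[OF refl])
    fix x assume "x \<in> space ?M"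
    then have "a \<le> x" "x \<le> b" by auto
    have "(\<integral>y. ?D x y \<partial>?M) = (\<integral>y. f x * (indicator {..x} y * g y) \<partial>?M)"
      by (rule Bochner_Integration.integral_cong) auto
    then show "(\<integral>y. ?D x y \<partial>?M) = f x * integral {a..x} g"
      using lebesgue_integral_initial_segment(1)[OF g \<open>a \<le> x\<close> \<open>x \<le> b\<close>] by simp
  qed
  also have "\<dots> = integral {a..b} (\<lambda>x. f x * integral {a..x} g)"
    by (intro lebesgue_integral_eq_integral absolutely_integrable_imp_integrable ai) auto
  also have "integral\<^sup>L (?M \<Otimes>\<^sub>M ?M) (case_prod ?U) = (\<integral>y. \<integral>x. ?U x y \<partial>?M \<partial>?M)"
    using integral_snd[OF U] by simp
  also have "\<dots> = (\<integral>y. integral {a..y} f * g y \<partial>?M)"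
  proof (rule Bochner_Integration.integral_cong[OF refl])
    fix y assume "y \<in> space ?M"
    then have "a \<le> y" "y \<le> b" by auto
    have "(\<integral>x. ?U x y \<partial>?M) = (\<integral>x. (indicator {..<y} x * f x) * g y \<partial>?M)"
      by (rule Bochner_Integration.integral_cong) auto
    then show "(\<integral>x. ?U x y \<partial>?M) = integral {a..y} f * g y"
      using lebesgue_integral_initial_segment(2)[OF f \<open>a \<le> y\<close> \<open>y \<le> b\<close>] by simp
  qed
  also have "\<dots> = integral {a..b} (\<lambda>x. integral {a..x} f * g x)"
    by (intro lebesgue_integral_eq_integral absolutely_integrable_imp_integrable ai) auto
  also have "(\<integral>x. \<integral>y. f x * g y \<partial>?M \<partial>?M) = integral {a..b} f * integral {a..b} g"
    using lebesgue_integral_eq_integral[OF fi] lebesgue_integral_eq_integral[OF gi] by simp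
  finally show ?thesis by simp
qed

section \<open>Restriction, sums and products of absolutely continuous functions\<close>

text \<open>This is absolute continuity of \<open>F\<close> with almost everywhere derivative
  \<open>f\<close>. The integral identity makes the notion insensitive to changes of
  \<open>f\<close> on null sets and reduces the calculus to facts about integrals.\<close>

definition has_ac_derivative :: "(real \<Rightarrow> real) \<Rightarrow> (real \<Rightarrow> real) \<Rightarrow> real \<Rightarrow> real \<Rightarrow> bool" where
  "has_ac_derivative F f a b \<longleftrightarrow> f absolutely_integrable_on {a..b} \<and>
     (\<forall>x\<in>{a..b}. F x - F a = integral {a..x} f)"

lemma has_ac_derivativeD:
  assumes "has_ac_derivative F f a b"
  shows "f absolutely_integrable_on {a..b}" "f integrable_on {a..b}"
    "a \<le> x \<Longrightarrow> x \<le> b \<Longrightarrow> F x - F a = integral {a..x} f"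
  using assms by (auto simp: has_ac_derivative_def intro: set_lebesgue_integral_eq_integral(1))

lemma has_ac_derivativeI:
  assumes "f absolutely_integrable_on {a..b}"
    and "\<And>x. a \<le> x \<Longrightarrow> x \<le> b \<Longrightarrow> F x - F a = integral {a..x} f"
  shows "has_ac_derivative F f a b"
  using assms by (auto simp: has_ac_derivative_def)

lemma has_ac_derivative_integral:
  assumes "f absolutely_integrable_on {a..b}"
  shows "has_ac_derivative (\<lambda>x. c + integral {a..x} f) f a b"
  using assms by (intro has_ac_derivativeI) auto

lemma has_ac_derivative_diff_eq:
  assumes F: "has_ac_derivative F f a b" and "a \<le> s" "s \<le> t" "t \<le> b"
  shows "F t - F s = integral {s..t} f"
proof -
  have "f integrable_on {a..t}"
    using has_ac_derivativeD(2)[OF F] assms by (rule_tac integrable_subinterval_real) auto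
  then show ?thesis
    using Henstock_Kurzweil_Integration.integral_combine[of a s t f] assms
      has_ac_derivativeD(3)[OF F, of s] has_ac_derivativeD(3)[OF F, of t] by linarith
qed

lemma has_ac_derivative_subinterval:
  assumes F: "has_ac_derivative F f a b" and "a \<le> s" "t \<le> b"
  shows "has_ac_derivative F f s t"
proof (rule has_ac_derivativeI)
  show "f absolutely_integrable_on {s..t}"
    by (rule absolutely_integrable_on_subinterval[OF has_ac_derivativeD(1)[OF F]]) (use assms in auto)
qed (use has_ac_derivative_diff_eq[OF F] assms in auto)

lemma has_ac_derivative_continuous_on:
  assumes "has_ac_derivative F f a b"
  shows "continuous_on {a..b} F"
proof -
  have "continuous_on {a..b} (\<lambda>x. F a + integral {a..x} f)"
    by (intro continuous_on_add continuous_on_const indefinite_integral_continuous_1 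
       has_ac_derivativeD(2)[OF assms])
  moreover have "F a + integral {a..x} f = F x" if "x \<in> {a..b}" for x
    using has_ac_derivativeD(3)[OF assms, of x] that by auto
  ultimately show ?thesis
    by (rule continuous_on_eq)
qed

lemma has_ac_derivative_C1:
  assumes "continuous_on {a..b} f"
    and "\<And>x. x \<in> {a..b} \<Longrightarrow> (F has_real_derivative f x) (at x within {a..b})"
  shows "has_ac_derivative F f a b"
proof (rule has_ac_derivativeI)
  show "f absolutely_integrable_on {a..b}"
    by (rule absolutely_integrable_continuous_real[OF assms(1)])
  fix x assume x: "a \<le> x" "x \<le> b"
  have "(f has_integral (F x - F a)) {a..x}"
  proof (rule fundamental_theorem_of_calculus)
    show "(F has_vector_derivative f y) (at y within {a..x})" if "y \<in> {a..x}" for y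
      using assms(2)[of y] that x unfolding has_real_derivative_iff_has_vector_derivative[symmetric]
      by (auto intro: DERIV_subset)
  qed (use x in auto)
  then show "F x - F a = integral {a..x} f" by (simp add: integral_unique)
qed

lemma has_ac_derivative_cong:
  assumes F: "has_ac_derivative F f a b"
    and "negligible N" "\<And>x. x \<in> {a..b} - N \<Longrightarrow> g x = f x" "\<And>x. x \<in> {a..b} \<Longrightarrow> G x = F x"
  shows "has_ac_derivative G g a b"
proof (rule has_ac_derivativeI)
  show "g absolutely_integrable_on {a..b}"
    by (rule absolutely_integrable_spike[OF has_ac_derivativeD(1)[OF F]]) (use assms in auto)
  fix x assume x: "a \<le> x" "x \<le> b"
  have "integral {a..x} f = integral {a..x} g"
    by (rule integral_spike[OF \<open>negligible N\<close>]) (use assms x in auto)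
  then show "G x - G a = integral {a..x} g"
    using has_ac_derivativeD(3)[OF F x] assms x by auto
qed

lemma has_ac_derivative_add:
  assumes F: "has_ac_derivative F f a b" and G: "has_ac_derivative G g a b"
  shows "has_ac_derivative (\<lambda>x. F x + G x) (\<lambda>x. f x + g x) a b"
proof (rule has_ac_derivativeI)
  show "(\<lambda>x. f x + g x) absolutely_integrable_on {a..b}"
    using has_ac_derivativeD(1)[OF F] has_ac_derivativeD(1)[OF G] by auto
  fix x assume x: "a \<le> x" "x \<le> b"
  have "integral {a..x} (\<lambda>x. f x + g x) = integral {a..x} f + integral {a..x} g"
    using has_ac_derivative_subinterval[OF F, of a x] has_ac_derivative_subinterval[OF G, of a x] x
    by (intro Henstock_Kurzweil_Integration.integral_add) (auto intro: has_ac_derivativeD(2))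
  then show "F x + G x - (F a + G a) = integral {a..x} (\<lambda>x. f x + g x)"
    using has_ac_derivativeD(3)[OF F x] has_ac_derivativeD(3)[OF G x] by simp
qed

lemma has_ac_derivative_cmult:
  assumes F: "has_ac_derivative F f a b"
  shows "has_ac_derivative (\<lambda>x. c * F x) (\<lambda>x. c * f x) a b"
proof (rule has_ac_derivativeI)
  show "(\<lambda>x. c * f x) absolutely_integrable_on {a..b}"
    using has_ac_derivativeD(1)[OF F] by auto
  show "c * F x - c * F a = integral {a..x} (\<lambda>x. c * f x)" if "a \<le> x" "x \<le> b" for x
    using has_ac_derivativeD(3)[OF F that] by (simp flip: right_diff_distrib)
qed

text \<open>Write \<open>F\<close> and \<open>G\<close> as initial value plus primitive: the product
  of the two primitives is the Fubini identity, and the initial values contribute only linear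
  terms.\<close>

lemma has_ac_derivative_mult:
  assumes F: "has_ac_derivative F f a b" and G: "has_ac_derivative G g a b"
  shows "has_ac_derivative (\<lambda>x. F x * G x) (\<lambda>x. f x * G x + F x * g x) a b"
proof (rule has_ac_derivativeI)
  \<comment> \<open>Stated for arbitrary functions and right end point, since it is applied to
    \<open>F\<close> and \<open>G\<close> on \<open>{a..b}\<close> and again to the bare primitives
    on \<open>{a..x}\<close>.\<close>
  have *: "(\<lambda>x. f x * G x) absolutely_integrable_on {a..b}" "(\<lambda>x. F x * g x) absolutely_integrable_on {a..b}"
   if "has_ac_derivative F f a b" "has_ac_derivative G g a b" for F f G g b
    using continuous_mult_absolutely_integrable[of a b G f] continuous_mult_absolutely_integrable[of a b F g]
      that[THEN has_ac_derivative_continuous_on] that[THEN has_ac_derivativeD(1)]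
    by (simp_all add: mult.commute)
  then show "(\<lambda>x. f x * G x + F x * g x) absolutely_integrable_on {a..b}"
    using assms by (intro set_integral_add)
  fix x assume x: "a \<le> x" "x \<le> b"
  have Fx: "has_ac_derivative F f a x" and Gx: "has_ac_derivative G g a x"
    using assms x by (auto intro: has_ac_derivative_subinterval)
  have fi: "f absolutely_integrable_on {a..x}" and gi: "g absolutely_integrable_on {a..x}"
    using Fx Gx by (auto intro: has_ac_derivativeD)
  have i: "(\<lambda>y. f y * integral {a..y} g) integrable_on {a..x}" "(\<lambda>y. integral {a..y} f * g y) integrable_on {a..x}"
    "(\<lambda>y. G a * f y) integrable_on {a..x}" "(\<lambda>y. F a * g y) integrable_on {a..x}"
    using *[OF has_ac_derivative_integral[OF fi, of 0] has_ac_derivative_integral[OF gi, of 0]] fi gi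
    by (auto intro: set_lebesgue_integral_eq_integral(1) integrable_on_mult_right)
  have "integral {a..x} (\<lambda>x. f x * G x + F x * g x) =
     integral {a..x} (\<lambda>y. (f y * integral {a..y} g + integral {a..y} f * g y) + (G a * f y + F a * g y))"
  proof (rule integral_cong)
    fix y assume "y \<in> {a..x}"
    then have I: "integral {a..y} f = F y - F a" "integral {a..y} g = G y - G a"
      using has_ac_derivativeD(3)[OF Fx, of y] has_ac_derivativeD(3)[OF Gx, of y] by auto
    show "f y * G y + F y * g y = (f y * integral {a..y} g + integral {a..y} f * g y) + (G a * f y + F a * g y)"
      unfolding I by (simp add: algebra_simps)
  qed
  also have "\<dots> = integral {a..x} f * integral {a..x} g + (G a * integral {a..x} f + F a * integral {a..x} g)"
    unfolding Henstock_Kurzweil_Integration.integral_add[OF integrable_add[OF i(1,2)] integrable_add[OF i(3,4)]]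
      Henstock_Kurzweil_Integration.integral_add[OF i(1,2)] Henstock_Kurzweil_Integration.integral_add[OF i(3,4)]
    using integral_mult_primitives[OF fi gi] by simp
  also have "\<dots> = F x * G x - F a * G a"
    unfolding has_ac_derivativeD(3)[OF F x, symmetric] has_ac_derivativeD(3)[OF G x, symmetric]
    by (simp add: algebra_simps)
  finally show "F x * G x - F a * G a = integral {a..x} (\<lambda>x. f x * G x + F x * g x)" by simp
qed

section \<open>Smooth bumps and weak derivatives\<close>

text \<open>\<open>flat 0\<close> is the classical smooth function vanishing to infinite order at 0.
  Dividing by powers of \<open>x\<close> gives a family whose linear span is closed under
  differentiation.\<close>

definition flat :: "nat \<Rightarrow> real \<Rightarrow> real" where
  "flat n x = (if 0 < x then exp (- 1 / x) / x ^ n else 0)"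

text \<open>With \<open>y = 1 / x\<close> the limit from the right is that of
  \<open>y ^ n / exp y\<close> at infinity.\<close>

lemma flat_tendsto_0: "(flat n \<longlongrightarrow> 0) (at 0)"
proof -
  have "((\<lambda>x. inverse x ^ n / exp (inverse x)) \<longlongrightarrow> (0::real)) (at_right 0)"
    by (rule filterlim_compose[OF tendsto_power_div_exp_0 filterlim_inverse_at_top_right])
  then have "(flat n \<longlongrightarrow> 0) (at_right 0)"
    by (rule Lim_transform_eventually)
       (auto simp: flat_def eventually_at_right_field exp_minus divide_simps intro!: exI[of _ 1])
  moreover have "(flat n \<longlongrightarrow> 0) (at_left 0)"
    by (rule tendsto_eventually) (auto simp: flat_def eventually_at_left_field intro!: exI[of _ "-1"])
  ultimately show ?thesis
    by (simp add: filterlim_split_at)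
qed

lemma flat_has_derivative:
  "(flat n has_real_derivative flat (n + 2) x - real n * flat (n + 1) x) (at x)"
proof (cases x "0 :: real" rule: linorder_cases)
  case less
  have "((\<lambda>_. 0 :: real) has_real_derivative 0) (at x)" by simp
  then have "(flat n has_real_derivative 0) (at x)"
    by (rule has_field_derivative_transform_within_open[where S = "{..<0}"]) (use less in \<open>auto simp: flat_def\<close>)
  then show ?thesis using less by (simp add: flat_def)
next
  case equal
  \<comment> \<open>At 0 the difference quotient of \<open>flat n\<close> is
    \<open>flat (Suc n)\<close>, which tends to 0.\<close>
  have "((\<lambda>h. (flat n (0 + h) - flat n 0) / h) \<longlongrightarrow> 0) (at 0)"
    by (rule Lim_transform_eventually[OF flat_tendsto_0[of "Suc n"]])
       (auto simp: flat_def eventually_at intro!: exI[of _ 1])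
  then show ?thesis using equal by (simp add: DERIV_def flat_def)
next
  case greater
  have "((\<lambda>x. exp (- 1 / x) / x ^ n) has_real_derivative flat (n + 2) x - real n * flat (n + 1) x) (at x)"
    using greater
    by (cases n; auto intro!: derivative_eq_intros simp: flat_def divide_simps; auto simp: algebra_simps power2_eq_square power_eq_if)
  then show ?thesis
    by (rule has_field_derivative_transform_within_open[where S = "{0<..}"]) (use greater in \<open>auto simp: flat_def\<close>)
qed

text \<open>A space that differentiation maps into itself. Smoothness of all orders then follows by
  induction from differentiability of its members, with no formula for higher derivatives.\<close>

inductive_set bump_span :: "(real \<Rightarrow> real) set" where
  base: "(\<lambda>x. flat m (x - s) * flat n (t - x)) \<in> bump_span"
| add: "f \<in> bump_span \<Longrightarrow> g \<in> bump_span \<Longrightarrow> (\<lambda>x. f x + g x) \<in> bump_span"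
| cmult: "f \<in> bump_span \<Longrightarrow> (\<lambda>x. c * f x) \<in> bump_span"

lemma bump_span_derivative:
  assumes "f \<in> bump_span"
  shows "\<exists>g\<in>bump_span. \<forall>x. (f has_real_derivative g x) (at x)"
  using assms
proof induction
  case (base m s n t)
  let ?g = "\<lambda>x. (flat (m + 2) (x - s) * flat n (t - x) + (- real m) * (flat (m + 1) (x - s) * flat n (t - x))) +
    (-1) * (flat m (x - s) * flat (n + 2) (t - x) + (- real n) * (flat m (x - s) * flat (n + 1) (t - x)))"
  have "?g \<in> bump_span"
    by (intro bump_span.intros)
  moreover have "((\<lambda>x. flat m (x - s) * flat n (t - x)) has_real_derivative ?g x) (at x)" for x
  proof -
    have 1: "((\<lambda>x. flat m (x - s)) has_real_derivative (flat (m + 2) (x - s) - real m * flat (m + 1) (x - s)) * 1) (at x)"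
      by (rule DERIV_chain2[OF flat_has_derivative]) (auto intro!: derivative_eq_intros)
    have 2: "((\<lambda>x. flat n (t - x)) has_real_derivative (flat (n + 2) (t - x) - real n * flat (n + 1) (t - x)) * (- 1)) (at x)"
      by (rule DERIV_chain2[OF flat_has_derivative]) (auto intro!: derivative_eq_intros)
    show ?thesis
      by (rule DERIV_cong[OF DERIV_mult[OF 1 2]]) (simp add: algebra_simps)
  qed
  ultimately show ?case by (intro bexI[of _ ?g] allI)
next
  case (add f g)
  then obtain f' g' where "f' \<in> bump_span" "g' \<in> bump_span"
    "\<forall>x. (f has_real_derivative f' x) (at x)" "\<forall>x. (g has_real_derivative g' x) (at x)" by blast
  then show ?case
    by (intro bexI[of _ "\<lambda>x. f' x + g' x"] bump_span.intros) (auto intro: DERIV_add)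
next
  case (cmult f c)
  then obtain f' where "f' \<in> bump_span" "\<forall>x. (f has_real_derivative f' x) (at x)" by blast
  then show ?case
    by (intro bexI[of _ "\<lambda>x. c * f' x"] bump_span.intros) (auto intro: DERIV_cmult)
qed

lemma bump_span_deriv: "f \<in> bump_span \<Longrightarrow> deriv f \<in> bump_span"
  using bump_span_derivative[of f] by (metis DERIV_imp_deriv ext)

lemma bump_span_deriv_iter: "f \<in> bump_span \<Longrightarrow> (deriv ^^ k) f \<in> bump_span"
  by (induction k) (auto intro: bump_span_deriv)

lemma bump_span_differentiable: "f \<in> bump_span \<Longrightarrow> f differentiable at x"
  using bump_span_derivative real_differentiable_def by blast

lemma bump_span_continuous: "f \<in> bump_span \<Longrightarrow> continuous_on S f"
  by (meson bump_span_differentiable differentiable_imp_continuous_within continuous_at_imp_continuous_on)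

text \<open>The product of the two flat functions is positive exactly on the open interval, so its
  integral is positive and can be normalised.\<close>

lemma unit_bump_exists:
  fixes s t :: real
  assumes "s < t"
  obtains \<rho> where "\<rho> \<in> bump_span" "\<And>x. 0 \<le> \<rho> x" "\<And>x. x \<notin> {s..t} \<Longrightarrow> \<rho> x = 0" "integral {s..t} \<rho> = 1"
proof -
  define b where "b = (\<lambda>x. flat 0 (x - s) * flat 0 (t - x))"
  have b: "b \<in> bump_span" unfolding b_def by (rule bump_span.base)
  have b0: "0 \<le> b x" for x by (simp add: b_def flat_def)
  have "b ((s + t) / 2) > 0" using assms by (simp add: b_def flat_def)
  then have "integral {s..t} b \<noteq> 0"
    using integral_eq_0_iff[OF bump_span_continuous[OF b] assms b0] assms by (force dest: bspec[of _ _ "(s + t) / 2"])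
  moreover have "integral {s..t} b \<ge> 0"
    by (rule Henstock_Kurzweil_Integration.integral_nonneg) (auto intro: integrable_continuous_real bump_span_continuous b b0)
  ultimately have I: "integral {s..t} b > 0" by simp
  show thesis
  proof
    show "(\<lambda>x. (1 / integral {s..t} b) * b x) \<in> bump_span" using b by (rule bump_span.cmult)
  qed (use I b0 in \<open>auto simp: b_def flat_def\<close>)
qed

section \<open>From weak derivatives to primitives\<close>

text \<open>Weak formulations integrate over the open unit interval, the calculus above over compact
  intervals. Allowing \<open>d = 1\<close> costs only the point 1, a null set.\<close>

lemma LINT_unit_interval:
  fixes h :: "real \<Rightarrow> real"
  assumes h: "h absolutely_integrable_on {c..d}" and "0 < c" "d \<le> 1"
    and 0: "\<And>x. 0 < x \<Longrightarrow> x < 1 \<Longrightarrow> x \<notin> {c..d} \<Longrightarrow> h x = 0"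
  shows "(LINT r|unit_interval_measure. h r) = integral {c..d} h" (is ?A)
    and "integrable unit_interval_measure h" (is ?B)
proof -
  have h': "h absolutely_integrable_on {0<..<1}"
    by (rule absolutely_integrable_spike_set[OF h]; rule negligible_subset[of "{1}"]) (use assms in force)+
  then show ?B by (rule absolutely_integrable_imp_integrable) auto
  then have "(LINT r|unit_interval_measure. h r) = integral {0<..<1} h"
    by (rule lebesgue_integral_eq_integral) auto
  also have "\<dots> = integral {c..d} h"
    by (rule integral_spike_set; rule negligible_subset[of "{1}"]) (use assms in force)+
  finally show ?A .
qed

text \<open>Serves to replace point values of a continuous function by averages against narrow
  bumps. The bound by \<open>e\<close> is asked only where the weight is nonzero, so that continuity
  at one point can supply it.\<close>

lemma abs_weighted_mean_diff_le:
  fixes u \<rho> :: "real \<Rightarrow> real"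
  assumes u: "continuous_on {c..d} u" and \<rho>: "continuous_on {c..d} \<rho>" "integral {c..d} \<rho> = 1"
    and "\<And>x. x \<in> {c..d} \<Longrightarrow> 0 \<le> \<rho> x" "\<And>x. x \<in> {c..d} \<Longrightarrow> \<rho> x \<noteq> 0 \<Longrightarrow> \<bar>u x - k\<bar> \<le> e"
  shows "\<bar>integral {c..d} (\<lambda>x. u x * \<rho> x) - k\<bar> \<le> e"
proof -
  have "integral {c..d} (\<lambda>x. u x * \<rho> x) - k = integral {c..d} (\<lambda>x. u x * \<rho> x) - integral {c..d} (\<lambda>x. k * \<rho> x)"
    using \<rho> by simp
  also have "\<dots> = integral {c..d} (\<lambda>x. u x * \<rho> x - k * \<rho> x)"
    by (rule Henstock_Kurzweil_Integration.integral_diff[symmetric])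
       (intro integrable_continuous_real continuous_intros u \<rho>)+
  also have "norm \<dots> \<le> integral {c..d} (\<lambda>x. e * \<rho> x)"
  proof (rule Henstock_Kurzweil_Integration.integral_norm_bound_integral)
    fix x assume x: "x \<in> {c..d}"
    have "\<bar>u x - k\<bar> * \<rho> x \<le> e * \<rho> x"
      using assms(4,5)[OF x] by (cases "\<rho> x = 0") (auto intro: mult_right_mono)
    then show "norm (u x * \<rho> x - k * \<rho> x) \<le> e * \<rho> x"
      using assms(4)[OF x] by (simp add: abs_mult flip: left_diff_distrib)
  qed (intro integrable_continuous_real continuous_intros u \<rho>)+
  also have "\<dots> = e" using \<rho> by simp
  finally show ?thesis by simp
qed

text \<open>The primitive starting at \<open>a\<close> vanishes left of \<open>a\<close> by the
  support condition and right of \<open>b\<close> by the zero mean. Its derivatives of positive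
  order are those of \<open>g\<close>, hence exist.\<close>

lemma test_function_antiderivative:
  assumes g: "g \<in> bump_span" and "0 < a" "a < b" "b < 1"
    and supp: "\<And>x. x \<notin> {a..b} \<Longrightarrow> g x = 0" and int: "integral {a..b} g = 0"
  obtains \<eta> where "\<eta> \<in> test_functions" "\<And>x. (\<eta> has_real_derivative g x) (at x)" "\<And>x. x \<notin> {a..b} \<Longrightarrow> \<eta> x = 0"
proof -
  obtain G where G: "\<And>x. (G has_real_derivative g x) (at x)"
  proof -
    have "\<exists>F. \<forall>x::real. -\<infinity> < ereal x \<longrightarrow> ereal x < \<infinity> \<longrightarrow> (F has_vector_derivative g x) (at x)"
      using g bump_span_continuous[OF g, of UNIV] by (intro einterval_antiderivative) (auto simp: continuous_on_eq_continuous_at)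
    then show ?thesis using that by (auto simp: has_real_derivative_iff_has_vector_derivative)
  qed
  have ftc: "integral {x..y} g = G y - G x" if "x \<le> y" for x y
    using that G by (intro integral_unique fundamental_theorem_of_calculus)
      (auto simp flip: has_real_derivative_iff_has_vector_derivative intro: has_field_derivative_at_within)
  define \<eta> where "\<eta> = (\<lambda>x. G x - G a)"
  have \<eta>': "(\<eta> has_real_derivative g x) (at x)" for x
    unfolding \<eta>_def using DERIV_diff[OF G[of x] DERIV_const[of "G a"]] by simp
  have zero: "\<eta> x = 0" if "x \<notin> {a..b}" for x
  proof (cases "x < a")
    case True
    have "integral {x..a} g = integral {x..a} (\<lambda>_. 0)"
      by (rule integral_spike[of "{a}"]) (use True supp in auto)
    then show ?thesis using ftc[of x a] True by (simp add: \<eta>_def)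
  next
    case False
    then have "x > b" using that by auto
    have "integral {b..x} g = integral {b..x} (\<lambda>_. 0)"
      by (rule integral_spike[of "{b}"]) (use \<open>x > b\<close> supp in auto)
    then show ?thesis using ftc[of b x] ftc[of a b] \<open>x > b\<close> \<open>a < b\<close> int by (simp add: \<eta>_def)
  qed
  have d: "deriv \<eta> = g" using \<eta>' DERIV_imp_deriv by blast
  have "(deriv ^^ k) \<eta> differentiable at x" for k x
  proof (cases k)
    case 0
    then show ?thesis using \<eta>' by (auto simp: real_differentiable_def)
  next
    case (Suc j)
    then show ?thesis using bump_span_deriv_iter[OF g, of j] bump_span_differentiable d by (simp add: funpow_swap1)
  qed
  then have "\<eta> \<in> test_functions" using zero assms by (auto simp: test_functions_def)
  then show thesis using that \<eta>' zero by blast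
qed

text \<open>Testing with \<open>\<eta>' = \<rho>\<^sub>1 - \<rho>\<^sub>2\<close>, two unit bumps just to the right of \<open>s\<close> and of \<open>t\<close>, shows that
  the averages of \<open>v\<close> minus the primitive of \<open>w\<close> near \<open>s\<close> and near \<open>t\<close> agree.\<close>

lemma weak_derivative_diff_eq:
  assumes vw: "has_weak_derivative v w" and v: "continuous_on {0<..<1} v" and st: "0 < s" "s \<le> t" "t < 1"
  shows "v t - v s = integral {s..t} w"
proof -
  \<comment> \<open>A compact interval inside \<open>(0,1)\<close> with room around
    \<open>[s,t]\<close>: \<open>w\<close> is integrable on it, and a bump to the right of
    \<open>t\<close> still fits.\<close>
  define c d where "c = s / 2" and "d = (1 + t) / 2"
  have cd: "0 < c" "c < s" "t < d" "d < 1" using st by (auto simp: c_def d_def)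
  have "w absolutely_integrable_on {c..d}"
    using vw cd st by (auto simp: has_weak_derivative_def locally_integrable_def)
  note W = has_ac_derivative_integral[OF this, of 0]
  define W where "W = (\<lambda>x. 0 + integral {c..x} w)"
  note W = W[folded W_def]
  define u where "u = (\<lambda>x. v x - W x)"
  have vc: "continuous_on {c..d} v"
    by (rule continuous_on_subset[OF v]) (use cd in auto)
  have uc: "continuous_on {c..d} u"
    unfolding u_def by (intro continuous_intros vc has_ac_derivative_continuous_on[OF W])
  have "u t = u s"
  proof (rule ccontr)
    assume ne: "u t \<noteq> u s"
    then have "s < t" using st by (cases "s = t") auto
    \<comment> \<open>One third of the gap: the averages near \<open>s\<close> and near
      \<open>t\<close> coincide and each is within \<open>e\<close> of the value there, so the gap
      would be at most \<open>2 * e\<close>.\<close>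
    define e where "e = \<bar>u t - u s\<bar> / 3"
    have "e > 0" using ne by (simp add: e_def)
    obtain e1 where e1: "e1 > 0" "\<And>x. x \<in> {c..d} \<Longrightarrow> \<bar>x - s\<bar> < e1 \<Longrightarrow> \<bar>u x - u s\<bar> < e"
      using uc[unfolded continuous_on_iff, rule_format, of s e] \<open>e > 0\<close> cd st by (auto simp: dist_real_def)
    obtain e2 where e2: "e2 > 0" "\<And>x. x \<in> {c..d} \<Longrightarrow> \<bar>x - t\<bar> < e2 \<Longrightarrow> \<bar>u x - u t\<bar> < e"
      using uc[unfolded continuous_on_iff, rule_format, of t e] \<open>e > 0\<close> cd st by (auto simp: dist_real_def)
    define \<epsilon> where "\<epsilon> = min (min (e1 / 2) (e2 / 2)) (d - t)"
    have \<epsilon>: "\<epsilon> > 0" "\<epsilon> < e1" "\<epsilon> < e2" "t + \<epsilon> \<le> d" using e1 e2 cd by (auto simp: \<epsilon>_def)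
    obtain p where p: "p \<in> bump_span" "\<And>x. 0 \<le> p x" "\<And>x. x \<notin> {s..s+\<epsilon>} \<Longrightarrow> p x = 0" "integral {s..s+\<epsilon>} p = 1"
      using unit_bump_exists[of s "s + \<epsilon>"] \<epsilon> by auto
    obtain q where q: "q \<in> bump_span" "\<And>x. 0 \<le> q x" "\<And>x. x \<notin> {t..t+\<epsilon>} \<Longrightarrow> q x = 0" "integral {t..t+\<epsilon>} q = 1"
      using unit_bump_exists[of t "t + \<epsilon>"] \<epsilon> by auto
    have "integral {c..d} p = integral {s..s+\<epsilon>} p" "integral {c..d} q = integral {t..t+\<epsilon>} q"
      by (rule integral_spike_set; rule negligible_subset[of "{}"]; use p(3) q(3) cd st \<epsilon> in force)+
    then have I1: "integral {c..d} p = 1" "integral {c..d} q = 1" using p q by auto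
    note pc = bump_span_continuous[OF p(1)] and qc = bump_span_continuous[OF q(1)]
    define g where "g = (\<lambda>x. p x + (-1) * q x)"
    have g: "g \<in> bump_span" unfolding g_def by (intro bump_span.intros p q)
    have "integral {c..d} g = 0"
      unfolding g_def
      by (subst Henstock_Kurzweil_Integration.integral_add) (auto intro!: integrable_continuous_real continuous_intros pc qc simp: I1)
    moreover have gz: "g x = 0" if "x \<notin> {c..d}" for x using that p(3)[of x] q(3)[of x] cd st \<epsilon> by (auto simp: g_def)
    ultimately obtain \<eta> where \<eta>: "\<eta> \<in> test_functions" "\<And>x. (\<eta> has_real_derivative g x) (at x)" "\<And>x. x \<notin> {c..d} \<Longrightarrow> \<eta> x = 0"
      using test_function_antiderivative[OF g, of c d] cd st by auto
    have d: "deriv \<eta> = g" using \<eta>(2) DERIV_imp_deriv by blast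
    have \<eta>c: "continuous_on S \<eta>" for S
      using \<eta>(2) by (meson DERIV_isCont continuous_at_imp_continuous_on)
    have gc: "continuous_on S g" for S using bump_span_continuous[OF g] .
    have \<eta>ac: "has_ac_derivative \<eta> g c d"
      by (rule has_ac_derivative_C1) (auto intro: gc has_field_derivative_at_within \<eta>)
    \<comment> \<open>Vanishing is known only outside \<open>{c..d}\<close>. The zero set of the
      continuous \<open>\<eta>\<close> is closed, so it contains the end points, and the boundary
      terms disappear.\<close>
    have "\<eta> c = 0" "\<eta> d = 0"
    proof -
      have "closed {x. \<eta> x = 0}"
        by (intro closed_Collect_eq \<eta>c continuous_on_const)
      moreover have "{..<c} \<subseteq> {x. \<eta> x = 0}" "{d<..} \<subseteq> {x. \<eta> x = 0}" using \<eta>(3) by auto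
      ultimately have "closure {..<c} \<subseteq> {x. \<eta> x = 0}" "closure {d<..} \<subseteq> {x. \<eta> x = 0}"
        by (simp_all only: closure_minimal)
      then show "\<eta> c = 0" "\<eta> d = 0" by auto
    qed
    note m = has_ac_derivativeD[OF has_ac_derivative_mult[OF W \<eta>ac]]
    have wi: "(\<lambda>x. w x * \<eta> x) absolutely_integrable_on {c..d}"
      using continuous_mult_absolutely_integrable[OF \<eta>c has_ac_derivativeD(1)[OF W]] by (simp add: mult.commute)
    have Wgi: "(\<lambda>x. W x * g x) integrable_on {c..d}"
      by (intro integrable_continuous_real continuous_intros gc has_ac_derivative_continuous_on[OF W])
    have vgi: "(\<lambda>x. v x * g x) absolutely_integrable_on {c..d}"
      by (intro absolutely_integrable_continuous_real continuous_intros gc vc)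
    have "integral {c..d} (\<lambda>x. w x * \<eta> x + W x * g x) = 0"
      using m(3)[of d] \<open>\<eta> c = 0\<close> \<open>\<eta> d = 0\<close> cd st by simp
    then have 1: "integral {c..d} (\<lambda>x. w x * \<eta> x) + integral {c..d} (\<lambda>x. W x * g x) = 0"
      using wi Wgi by (simp add: Henstock_Kurzweil_Integration.integral_add set_lebesgue_integral_eq_integral(1))
    have "(LINT r|unit_interval_measure. v r * g r) = - (LINT r|unit_interval_measure. w r * \<eta> r)"
      using vw \<eta>(1) d by (auto simp: has_weak_derivative_def)
    then have 2: "integral {c..d} (\<lambda>x. v x * g x) = - integral {c..d} (\<lambda>x. w x * \<eta> x)"
      using LINT_unit_interval(1)[OF vgi] LINT_unit_interval(1)[OF wi] cd st gz \<eta>(3) by simp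
    \<comment> \<open>The weak derivative identity for \<open>v\<close> and the product rule for
      \<open>W\<close> produce the same integral of \<open>w * \<eta>\<close>, so
      \<open>u = v - W\<close> is orthogonal to \<open>g = p - q\<close>.\<close>
    have "integral {c..d} (\<lambda>x. u x * p x) - integral {c..d} (\<lambda>x. u x * q x) = integral {c..d} (\<lambda>x. u x * p x - u x * q x)"
      by (rule Henstock_Kurzweil_Integration.integral_diff[symmetric]; intro integrable_continuous_real continuous_intros uc pc qc)
    also have "\<dots> = integral {c..d} (\<lambda>x. v x * g x - W x * g x)"
      by (intro integral_cong) (simp add: u_def g_def algebra_simps)
    also have "\<dots> = 0"
      using 1 2 vgi Wgi by (simp add: Henstock_Kurzweil_Integration.integral_diff set_lebesgue_integral_eq_integral(1))
    finally have 3: "integral {c..d} (\<lambda>x. u x * p x) = integral {c..d} (\<lambda>x. u x * q x)" by simp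
    have "\<bar>integral {c..d} (\<lambda>x. u x * p x) - u s\<bar> \<le> e"
    proof (rule abs_weighted_mean_diff_le[OF uc pc I1(1) p(2)])
      fix x assume "x \<in> {c..d}" "p x \<noteq> 0"
      then show "\<bar>u x - u s\<bar> \<le> e" using e1(2)[of x] p(3)[of x] \<epsilon> by fastforce
    qed
    moreover have "\<bar>integral {c..d} (\<lambda>x. u x * q x) - u t\<bar> \<le> e"
    proof (rule abs_weighted_mean_diff_le[OF uc qc I1(2) q(2)])
      fix x assume "x \<in> {c..d}" "q x \<noteq> 0"
      then show "\<bar>u x - u t\<bar> \<le> e" using e2(2)[of x] q(3)[of x] \<epsilon> by fastforce
    qed
    moreover have "\<bar>u t - u s\<bar> = 3 * e" by (simp add: e_def)
    ultimately show False using 3 \<open>e > 0\<close> by linarith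
  qed
  then show ?thesis
    using has_ac_derivative_diff_eq[OF W, of s t] cd st by (simp add: u_def)
qed

section \<open>Interior regularity\<close>

lemma AE_lebesgue_onE:
  assumes "AE x in lebesgue_on S. P x" "S \<in> sets lebesgue"
  obtains N where "negligible N" "\<And>x. x \<in> S - N \<Longrightarrow> P x"
proof -
  have "AE x in lebesgue. x \<in> S \<longrightarrow> P x"
    using assms by (simp add: AE_restrict_space_iff)
  then obtain N where "N \<in> null_sets lebesgue" "{x. \<not> (x \<in> S \<longrightarrow> P x)} \<subseteq> N"
    by (auto simp: eventually_ae_filter)
  then show thesis
    by (intro that[of N]) (auto simp: negligible_iff_null_sets)
qed

lemma integral_square_eq_0D:
  fixes k :: "real \<Rightarrow> real"
  assumes "(\<lambda>x. (k x)\<^sup>2) absolutely_integrable_on {a..b}" "integral {a..b} (\<lambda>x. (k x)\<^sup>2) = 0"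
  obtains N where "negligible N" "\<And>x. x \<in> {a..b} - N \<Longrightarrow> k x = 0"
proof -
  have i: "integrable (lebesgue_on {a..b}) (\<lambda>x. (k x)\<^sup>2)"
    using assms(1) by (rule absolutely_integrable_imp_integrable) auto
  have "(LINT x|lebesgue_on {a..b}. (k x)\<^sup>2) = 0"
    using assms(2) lebesgue_integral_eq_integral[OF i] by simp
  then have "AE x in lebesgue_on {a..b}. (k x)\<^sup>2 = 0"
    using integral_nonneg_eq_0_iff_AE[OF i] by simp
  then obtain N where "negligible N" "\<And>x. x \<in> {a..b} - N \<Longrightarrow> (k x)\<^sup>2 = 0"
    by (rule AE_lebesgue_onE) auto
  then show thesis using that by auto
qed

text \<open>Clipping at the essential bound alters the coefficient on a null set only and makes the
  bound hold everywhere, so that later estimates can be pointwise.\<close>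

lemma Linfinity_bounded_version:
  assumes "a \<in> Linfinity"
  obtains a' A N where "a' \<in> borel_measurable lebesgue" "\<And>r. \<bar>a' r\<bar> \<le> A" "negligible N"
    "\<And>r. r \<in> {0<..1} - N \<Longrightarrow> a r = a' r"
proof -
  from assms obtain C where am: "a \<in> borel_measurable unit_interval_measure"
    and C: "AE r in unit_interval_measure. \<bar>a r\<bar> \<le> C" by (auto simp: Linfinity_def)
  obtain N where N: "negligible N" "\<And>r. r \<in> {0<..<1} - N \<Longrightarrow> \<bar>a r\<bar> \<le> C"
    using C by (rule AE_lebesgue_onE) auto
  define b where "b = (\<lambda>r. if r \<in> {0<..<1} then a r else 0)"
  have [measurable]: "b \<in> borel_measurable lebesgue"
    unfolding b_def using am by (intro borel_measurable_if_I) auto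
  show thesis
  \<comment> \<open>\<open>\<bar>C\<bar>\<close> keeps the clipping interval nonempty for either
    sign of \<open>C\<close>. The point 1 joins the null set because the essential bound speaks of
    the open interval, whereas \<open>r\<close> ranges up to 1.\<close>
  proof (rule that[of "\<lambda>r. max (- \<bar>C\<bar>) (min \<bar>C\<bar> (b r))" "\<bar>C\<bar>" "insert 1 N"])
    show "a r = max (- \<bar>C\<bar>) (min \<bar>C\<bar> (b r))" if "r \<in> {0<..1} - insert 1 N" for r
      using N(2)[of r] that by (auto simp: b_def)
  qed (use N in auto)
qed

lemma measurable_mult_continuous_absolutely_integrable:
  fixes a c :: "real \<Rightarrow> real"
  assumes "a \<in> borel_measurable lebesgue" "\<And>r. \<bar>a r\<bar> \<le> A" "continuous_on {s..t} c"
  shows "(\<lambda>r. a r * c r) absolutely_integrable_on {s..t}"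
  by (rule absolutely_integrable_bounded_measurable_product_real)
     (use assms in \<open>auto intro: absolutely_integrable_continuous_real measurable_restrict_space1 simp: bounded_iff\<close>)

text \<open>On \<open>{s..1}\<close> the weight and its reciprocal are continuous, so weighted and
  plain square integrability agree there. Integrability of \<open>v\<close> itself follows from
  \<open>\<bar>v r\<bar> \<le> 1 + (v r)\<^sup>2\<close>.\<close>

lemma L2_local:
  assumes v: "v \<in> L2 M" and s: "0 < s"
  shows "v absolutely_integrable_on {s..1}" "(\<lambda>r. (v r)\<^sup>2) absolutely_integrable_on {s..1}"
proof -
  have vm: "v \<in> borel_measurable unit_interval_measure"
    and vi: "integrable unit_interval_measure (\<lambda>r. r powr (M - 1) * (v r)\<^sup>2)"
    using v by (auto simp: L2_def)
  have "(\<lambda>r. r powr (M - 1) * (v r)\<^sup>2) absolutely_integrable_on {0<..<1}"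
    using vi by (simp add: set_integrable_def integrable_restrict_space)
  then have "(\<lambda>r. r powr (M - 1) * (v r)\<^sup>2) absolutely_integrable_on {s<..<1}"
    by (rule set_integrable_subset) (use s in auto)
  then have 1: "(\<lambda>r. r powr (M - 1) * (v r)\<^sup>2) absolutely_integrable_on {s..1}"
    by (simp add: absolutely_integrable_on_Icc_iff_Ioo)
  have "continuous_on {s..1} (\<lambda>r. r powr (1 - M))"
    using s by (auto intro!: continuous_intros)
  from continuous_mult_absolutely_integrable[OF this 1]
  have "(\<lambda>r. r powr (1 - M) * (r powr (M - 1) * (v r)\<^sup>2)) absolutely_integrable_on {s..1}" .
  then show 2: "(\<lambda>r. (v r)\<^sup>2) absolutely_integrable_on {s..1}"
    by (rule absolutely_integrable_spike[of _ _ "{}"]) (use s in \<open>auto simp flip: mult.assoc powr_add\<close>)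
  have "v absolutely_integrable_on {s<..<1}"
  proof (rule measurable_bounded_by_integrable_imp_absolutely_integrable)
    show "v \<in> borel_measurable (lebesgue_on {s<..<1})"
      using vm by (rule measurable_restrict_mono) (use s in auto)
    have "(\<lambda>r. 1 + (v r)\<^sup>2) absolutely_integrable_on {s..1}"
      by (intro set_integral_add 2 absolutely_integrable_continuous_real continuous_intros)
    then show "(\<lambda>r. 1 + (v r)\<^sup>2) integrable_on {s<..<1}"
      by (simp add: absolutely_integrable_on_Icc_iff_Ioo set_lebesgue_integral_eq_integral(1))
    show "norm (v x) \<le> 1 + (v x)\<^sup>2" for x
      using sum_squares_bound[of 1 "\<bar>v x\<bar>"] unfolding power2_abs real_norm_def by simp
  qed auto
  then show "v absolutely_integrable_on {s..1}"
    by (simp add: absolutely_integrable_on_Icc_iff_Ioo)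
qed

lemma square_integrable_mult:
  fixes f g :: "real \<Rightarrow> real"
  assumes f: "f absolutely_integrable_on {a..b}" "(\<lambda>x. (f x)\<^sup>2) absolutely_integrable_on {a..b}"
    and g: "g absolutely_integrable_on {a..b}" "(\<lambda>x. (g x)\<^sup>2) absolutely_integrable_on {a..b}"
  shows "(\<lambda>x. f x * g x) absolutely_integrable_on {a..b}"
proof (rule measurable_bounded_by_integrable_imp_absolutely_integrable)
  show "(\<lambda>x. f x * g x) \<in> borel_measurable (lebesgue_on {a..b})"
    using absolutely_integrable_imp_borel_measurable[OF f(1)] absolutely_integrable_imp_borel_measurable[OF g(1)] by auto
  show "(\<lambda>x. (f x)\<^sup>2 + (g x)\<^sup>2) integrable_on {a..b}"
    using f g by (intro integrable_add set_lebesgue_integral_eq_integral(1))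
  show "norm (f x * g x) \<le> (f x)\<^sup>2 + (g x)\<^sup>2" for x
  proof -
    have "0 \<le> \<bar>f x\<bar> * \<bar>g x\<bar>" by simp
    then show ?thesis
      using sum_squares_bound[of "\<bar>f x\<bar>" "\<bar>g x\<bar>"] unfolding power2_abs real_norm_def abs_mult by linarith
  qed
qed auto

lemma square_integrable_add:
  fixes f g :: "real \<Rightarrow> real"
  assumes f: "f absolutely_integrable_on {a..b}" "(\<lambda>x. (f x)\<^sup>2) absolutely_integrable_on {a..b}"
    and g: "g absolutely_integrable_on {a..b}" "(\<lambda>x. (g x)\<^sup>2) absolutely_integrable_on {a..b}"
  shows "(\<lambda>x. (f x + g x)\<^sup>2) absolutely_integrable_on {a..b}"
proof -
  have "(\<lambda>x. ((f x)\<^sup>2 + (g x)\<^sup>2) + 2 * (f x * g x)) absolutely_integrable_on {a..b}"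
    by (intro set_integral_add set_integrable_mult_right assms square_integrable_mult)
  then show ?thesis
    by (simp add: power2_sum mult.assoc)
qed

section \<open>Test functions with prescribed derivative and the flux identity\<close>

text \<open>\<open>max s x\<close> extends the primitive by 0 to the left of \<open>s\<close>, which
  makes every power weight harmless; the zero mean of \<open>k\<close> gives the boundary value at
  1.\<close>

lemma integral_max_primitive:
  fixes k :: "real \<Rightarrow> real"
  assumes ki: "k absolutely_integrable_on {s..1}" "(\<lambda>x. (k x)\<^sup>2) absolutely_integrable_on {s..1}"
    and k0: "integral {s..1} k = 0" and s: "0 < s" "s < 1"
  defines "\<phi> \<equiv> \<lambda>x. integral {s..max s x} k"
  shows "\<phi> \<in> H_0 M" "has_weak_derivative \<phi> (\<lambda>x. indicator {s..1} x * k x)"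
proof -
  let ?\<phi>' = "\<lambda>x. indicator {s..1} x * k x"
  have \<phi>0: "\<phi> x = 0" if "x \<le> s" for x using that by (simp add: \<phi>_def max_absorb1)
  have \<phi>e: "\<phi> x = integral {s..x} k" if "s \<le> x" for x using that by (simp add: \<phi>_def max_absorb2)
  have ac: "has_ac_derivative \<phi> k s 1"
    by (rule has_ac_derivativeI[OF ki(1)]) (simp add: \<phi>e)
  have \<phi>c: "continuous_on {0<..1} \<phi>"
    unfolding \<phi>_def
    by (rule continuous_on_compose2[OF indefinite_integral_continuous_1[of k s 1]])
       (use s ki in \<open>auto intro!: continuous_intros set_lebesgue_integral_eq_integral(1)\<close>)
  have \<phi>c': "continuous_on {s..1} \<phi>" by (rule has_ac_derivative_continuous_on[OF ac])
  have \<phi>m: "\<phi> \<in> borel_measurable unit_interval_measure"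
    by (intro continuous_imp_measurable_on_sets_lebesgue continuous_on_subset[OF \<phi>c]) auto
  have weight: "integrable unit_interval_measure (\<lambda>r. r powr \<alpha> * (\<phi> r)\<^sup>2)" for \<alpha>
    by (rule LINT_unit_interval(2)[of s 1])
       (use s \<phi>0 in \<open>auto intro!: absolutely_integrable_continuous_real continuous_intros \<phi>c'\<close>)
  have \<phi>'i: "integrable lebesgue ?\<phi>'"
    using ki(1) by (simp add: set_integrable_def)
  have "?\<phi>' \<in> L2 M"
    unfolding L2_def
  proof (intro CollectI conjI)
    show "?\<phi>' \<in> borel_measurable unit_interval_measure"
      using borel_measurable_integrable[OF \<phi>'i] by (rule measurable_restrict_space1)
    have "(\<lambda>r. r powr (M - 1) * (k r)\<^sup>2) absolutely_integrable_on {s..1}"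
      by (rule continuous_mult_absolutely_integrable[OF _ ki(2)]) (use s in \<open>auto intro!: continuous_intros\<close>)
    then have "(\<lambda>r. r powr (M - 1) * (?\<phi>' r)\<^sup>2) absolutely_integrable_on {s..1}"
      by (rule absolutely_integrable_spike[of _ _ "{}"]) auto
    then show "integrable unit_interval_measure (\<lambda>r. r powr (M - 1) * (?\<phi>' r)\<^sup>2)"
      by (rule LINT_unit_interval(2)) (use s in auto)
  qed
  moreover show weak: "has_weak_derivative \<phi> ?\<phi>'"
    unfolding has_weak_derivative_def
  proof (intro conjI ballI)
    show "\<phi> \<in> locally_integrable"
      unfolding locally_integrable_def
      by (auto intro!: absolutely_integrable_continuous_real continuous_on_subset[OF \<phi>c])
    show "?\<phi>' \<in> locally_integrable"
      unfolding locally_integrable_def set_integrable_def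
      by (intro CollectI allI impI integrable_mult_indicator \<phi>'i) auto
    fix \<eta> assume "\<eta> \<in> test_functions"
    then obtain a b where \<eta>: "\<And>k x. (deriv ^^ k) \<eta> differentiable at x" "b < 1" "\<And>x. x \<notin> {a..b} \<Longrightarrow> \<eta> x = 0"
      by (auto simp: test_functions_def)
    have \<eta>1: "\<eta> 1 = 0" using \<eta>(3)[of 1] \<open>b < 1\<close> by auto
    have \<eta>d: "(\<eta> has_real_derivative deriv \<eta> x) (at x)" for x
      using \<eta>(1)[of 0 x] by (simp add: DERIV_deriv_iff_real_differentiable)
    have \<eta>c: "continuous_on S \<eta>" for S
      using \<eta>d by (meson DERIV_isCont continuous_at_imp_continuous_on)
    have \<eta>'c: "continuous_on S (deriv \<eta>)" for S
      using \<eta>(1)[of 1] by (auto intro!: continuous_at_imp_continuous_on differentiable_imp_continuous_within)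
    have \<eta>ac: "has_ac_derivative \<eta> (deriv \<eta>) s 1"
      by (rule has_ac_derivative_C1) (auto intro: \<eta>'c has_field_derivative_at_within \<eta>d)
    have i1: "(\<lambda>r. \<phi> r * deriv \<eta> r) absolutely_integrable_on {s..1}"
      by (intro absolutely_integrable_continuous_real continuous_intros \<phi>c' \<eta>'c)
    have i2: "(\<lambda>r. k r * \<eta> r) absolutely_integrable_on {s..1}"
      using continuous_mult_absolutely_integrable[OF \<eta>c ki(1)] by (simp add: mult.commute)
    then have i3: "(\<lambda>r. ?\<phi>' r * \<eta> r) absolutely_integrable_on {s..1}"
      by (rule absolutely_integrable_spike[of _ _ "{}"]) auto
    \<comment> \<open>Integration by parts without boundary terms: \<open>\<phi>\<close> vanishes at
      \<open>s\<close> and \<open>\<eta>\<close> at 1.\<close>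
    have "integral {s..1} (\<lambda>r. k r * \<eta> r + \<phi> r * deriv \<eta> r) = 0"
      using has_ac_derivativeD(3)[OF has_ac_derivative_mult[OF ac \<eta>ac], of 1] s \<eta>1 \<phi>0[of s] by simp
    then have "integral {s..1} (\<lambda>r. \<phi> r * deriv \<eta> r) = - integral {s..1} (\<lambda>r. k r * \<eta> r)"
      using i1 i2 by (simp add: Henstock_Kurzweil_Integration.integral_add set_lebesgue_integral_eq_integral(1))
    also have "integral {s..1} (\<lambda>r. k r * \<eta> r) = integral {s..1} (\<lambda>r. ?\<phi>' r * \<eta> r)"
      by (intro integral_cong) auto
    finally show "(LINT r|unit_interval_measure. \<phi> r * deriv \<eta> r) = - (LINT r|unit_interval_measure. ?\<phi>' r * \<eta> r)"
      using LINT_unit_interval(1)[OF i1] LINT_unit_interval(1)[OF i3] s \<phi>0 by simp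
  qed
  ultimately show "\<phi> \<in> H_0 M"
    using \<phi>c \<phi>m weight[of "M - 1"] weight[of "M - 3"] k0 s \<phi>e[of 1]
    by (auto simp: H_0_def H1_0_def H1_def L2_def L_Hardy_def)
qed

lemma source_absolutely_integrable:
  fixes a \<psi> :: "real \<Rightarrow> real"
  assumes a: "a \<in> borel_measurable lebesgue" "\<And>r. \<bar>a r\<bar> \<le> A" and \<psi>: "continuous_on {0<..1} \<psi>" and s: "0 < s"
  shows "(\<lambda>r. r powr (M - 1) * (a r * \<psi> r) + \<nu> * (r powr (M - 3) * \<psi> r)) absolutely_integrable_on {s..1}"
proof -
  have \<psi>s: "continuous_on {s..1} \<psi>" by (rule continuous_on_subset[OF \<psi>]) (use s in auto)
  have "(\<lambda>r. a r * (r powr (M - 1) * \<psi> r)) absolutely_integrable_on {s..1}"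
    by (rule measurable_mult_continuous_absolutely_integrable[OF a]) (use s in \<open>auto intro!: continuous_intros \<psi>s\<close>)
  moreover have "(\<lambda>r. \<nu> * (r powr (M - 3) * \<psi> r)) absolutely_integrable_on {s..1}"
    by (rule absolutely_integrable_continuous_real) (use s in \<open>auto intro!: continuous_intros \<psi>s\<close>)
  ultimately show ?thesis by (simp add: mult.left_commute)
qed

text \<open>The test function is the primitive of \<open>k\<close>, the deviation of \<open>r\<^bsup>M-1\<^esup> w + \<integral> F\<close> from its mean
  over \<open>[s,1]\<close>; the weak formulation then says that \<open>\<integral> k\<^sup>2 = 0\<close>.\<close>

lemma weak_solution_flux:
  fixes a b \<psi> w :: "real \<Rightarrow> real"
  assumes sol: "weak_solution M b \<nu> \<psi>" and w: "w \<in> L2 M" "has_weak_derivative \<psi> w"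
    and a: "a \<in> borel_measurable lebesgue" "\<And>r. \<bar>a r\<bar> \<le> A"
    and N: "negligible N" "\<And>r. r \<in> {0<..1} - N \<Longrightarrow> b r = a r" and s: "0 < s" "s < 1"
  defines "F \<equiv> \<lambda>r. r powr (M - 1) * (a r * \<psi> r) + \<nu> * (r powr (M - 3) * \<psi> r)"
  obtains c N' where "negligible N'" "\<And>r. r \<in> {s..1} - N' \<Longrightarrow> r powr (M - 1) * w r = c - integral {s..r} F"
proof -
  have \<psi>c: "continuous_on {0<..1} \<psi>"
    using sol by (auto simp: weak_solution_def H_0_def H1_0_def H1_def)
  then have \<psi>s: "continuous_on {s..1} \<psi>" by (rule continuous_on_subset) (use s in auto)
  have Fi: "F absolutely_integrable_on {s..1}"
    unfolding F_def by (rule source_absolutely_integrable[OF a \<psi>c s(1)])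
  define \<Phi> where "\<Phi> = (\<lambda>x. 0 + integral {s..x} F)"
  have \<Phi>ac: "has_ac_derivative \<Phi> F s 1" unfolding \<Phi>_def by (rule has_ac_derivative_integral[OF Fi])
  note \<Phi>c = has_ac_derivative_continuous_on[OF \<Phi>ac]
  define p where "p = (\<lambda>r. r powr (M - 1) * w r)"
  have wi: "w absolutely_integrable_on {s..1}" "(\<lambda>r. (w r)\<^sup>2) absolutely_integrable_on {s..1}"
    using L2_local[OF w(1) s(1)] by auto
  have pc: "continuous_on {s..1} (\<lambda>r. r powr (M - 1))" using s by (auto intro!: continuous_intros)
  have p1: "p absolutely_integrable_on {s..1}"
    unfolding p_def by (rule continuous_mult_absolutely_integrable[OF pc wi(1)])
  have p2: "(\<lambda>r. (p r)\<^sup>2) absolutely_integrable_on {s..1}"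
    unfolding p_def power_mult_distrib
    by (rule continuous_mult_absolutely_integrable[OF continuous_on_power[OF pc] wi(2)])
  define m where "m = (integral {s..1} p + integral {s..1} \<Phi>) / (1 - s)"
  define k where "k = (\<lambda>r. p r + (\<Phi> r - m))"
  have \<Phi>m: "(\<lambda>r. \<Phi> r - m) absolutely_integrable_on {s..1}" "(\<lambda>r. (\<Phi> r - m)\<^sup>2) absolutely_integrable_on {s..1}"
    by (intro absolutely_integrable_continuous_real continuous_intros \<Phi>c)+
  have k1: "k absolutely_integrable_on {s..1}" unfolding k_def by (intro set_integral_add p1 \<Phi>m)
  have k2: "(\<lambda>r. (k r)\<^sup>2) absolutely_integrable_on {s..1}"
    unfolding k_def by (rule square_integrable_add[OF p1 p2 \<Phi>m])
  have \<Phi>i: "\<Phi> integrable_on {s..1}" by (rule integrable_continuous_real[OF \<Phi>c])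
  have "integral {s..1} k = integral {s..1} p + (integral {s..1} \<Phi> - integral {s..1} (\<lambda>_. m))"
    unfolding k_def
      Henstock_Kurzweil_Integration.integral_add[OF set_lebesgue_integral_eq_integral(1)[OF p1] integrable_diff[OF \<Phi>i integrable_const_ivl]]
      Henstock_Kurzweil_Integration.integral_diff[OF \<Phi>i integrable_const_ivl] ..
  also have "\<dots> = 0" using s by (simp add: m_def)
  finally have k0: "integral {s..1} k = 0" .
  define \<phi> where "\<phi> = (\<lambda>x. integral {s..max s x} k)"
  define \<phi>' where "\<phi>' = (\<lambda>x. indicator {s..1} x * k x)"
  have \<phi>: "\<phi> \<in> H_0 M" "has_weak_derivative \<phi> \<phi>'"
    unfolding \<phi>_def \<phi>'_def by (rule integral_max_primitive[OF k1 k2 k0 s])+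
  have \<phi>0: "\<phi> x = 0" if "x \<le> s" for x using that by (simp add: \<phi>_def max_absorb1)
  have \<phi>e: "\<phi> x = integral {s..x} k" if "s \<le> x" for x using that by (simp add: \<phi>_def max_absorb2)
  have \<phi>ac: "has_ac_derivative \<phi> k s 1" by (rule has_ac_derivativeI[OF k1]) (simp add: \<phi>e)
  note \<phi>c = has_ac_derivative_continuous_on[OF \<phi>ac]
  have i1: "(\<lambda>r. p r * k r) absolutely_integrable_on {s..1}" by (rule square_integrable_mult[OF p1 p2 k1 k2])
  have i2: "(\<lambda>r. a r * (r powr (M - 1) * \<psi> r * \<phi> r)) absolutely_integrable_on {s..1}"
    by (rule measurable_mult_continuous_absolutely_integrable[OF a]) (use s in \<open>auto intro!: continuous_intros \<psi>s \<phi>c\<close>)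
  have i3: "(\<lambda>r. r powr (M - 3) * \<psi> r * \<phi> r) absolutely_integrable_on {s..1}"
    by (rule absolutely_integrable_continuous_real) (use s in \<open>auto intro!: continuous_intros \<psi>s \<phi>c\<close>)
  \<comment> \<open>Passing from \<open>?l\<close> to \<open>?l'\<close> replaces the coefficient
    \<open>b\<close> by its bounded version \<open>a\<close>; the two integrands agree off the null
    set \<open>N\<close>.\<close>
  let ?l = "\<lambda>r. r powr (M - 1) * (w r * \<phi>' r - b r * \<psi> r * \<phi> r)"
  let ?l' = "\<lambda>r. p r * k r - a r * (r powr (M - 1) * \<psi> r * \<phi> r)"
  have ll: "?l r = ?l' r" if "r \<in> {s..1} - N" for r
    using N(2)[of r] s that by (simp add: \<phi>'_def p_def algebra_simps)
  have i4: "?l' absolutely_integrable_on {s..1}" using i1 i2 by (rule set_integral_diff)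
  have i5: "?l absolutely_integrable_on {s..1}" by (rule absolutely_integrable_spike[OF i4 N(1) ll])
  have "(LINT r|unit_interval_measure. ?l r) = \<nu> * (LINT r|unit_interval_measure. r powr (M - 3) * \<psi> r * \<phi> r)"
    using sol w(2) \<phi> unfolding weak_solution_def by blast
  also have "(LINT r|unit_interval_measure. ?l r) = integral {s..1} ?l"
    by (rule LINT_unit_interval(1)[OF i5]) (use s \<phi>0 in \<open>auto simp: \<phi>'_def\<close>)
  also have "\<dots> = integral {s..1} ?l'"
    by (rule integral_spike[OF N(1)]) (use ll in auto)
  also have "\<dots> = integral {s..1} (\<lambda>r. p r * k r) - integral {s..1} (\<lambda>r. a r * (r powr (M - 1) * \<psi> r * \<phi> r))"
    by (intro Henstock_Kurzweil_Integration.integral_diff set_lebesgue_integral_eq_integral(1) i1 i2)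
  also have "(LINT r|unit_interval_measure. r powr (M - 3) * \<psi> r * \<phi> r) = integral {s..1} (\<lambda>r. r powr (M - 3) * \<psi> r * \<phi> r)"
    by (rule LINT_unit_interval(1)[OF i3]) (use s \<phi>0 in auto)
  finally have "integral {s..1} (\<lambda>r. p r * k r) = integral {s..1} (\<lambda>r. a r * (r powr (M - 1) * \<psi> r * \<phi> r)) +
      \<nu> * integral {s..1} (\<lambda>r. r powr (M - 3) * \<psi> r * \<phi> r)" by simp
  also have "\<dots> = integral {s..1} (\<lambda>r. a r * (r powr (M - 1) * \<psi> r * \<phi> r) + \<nu> * (r powr (M - 3) * \<psi> r * \<phi> r))"
    using i2 i3 by (subst Henstock_Kurzweil_Integration.integral_add)
      (auto intro!: set_lebesgue_integral_eq_integral(1) integrable_on_mult_right)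
  also have "\<dots> = integral {s..1} (\<lambda>r. F r * \<phi> r)"
    by (intro integral_cong) (simp add: F_def algebra_simps)
  finally have 1: "integral {s..1} (\<lambda>r. p r * k r) = integral {s..1} (\<lambda>r. F r * \<phi> r)" .
  have i6: "(\<lambda>r. F r * \<phi> r) integrable_on {s..1}" "(\<lambda>r. \<Phi> r * k r) integrable_on {s..1}"
    using set_lebesgue_integral_eq_integral(1)[OF continuous_mult_absolutely_integrable[OF \<phi>c Fi]]
      set_lebesgue_integral_eq_integral(1)[OF continuous_mult_absolutely_integrable[OF \<Phi>c k1]]
    by (simp_all only: mult.commute)
  \<comment> \<open>Since \<open>\<phi>\<close> vanishes at both end points, integrating by parts
    turns the integral of \<open>F * \<phi>\<close> into minus that of \<open>\<Phi> * k\<close>.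
    With the previous identity, \<open>p + \<Phi>\<close> is orthogonal to \<open>k\<close>, and so
    is the constant \<open>m\<close>.\<close>
  have "integral {s..1} (\<lambda>r. F r * \<phi> r + \<Phi> r * k r) = 0"
    using has_ac_derivativeD(3)[OF has_ac_derivative_mult[OF \<Phi>ac \<phi>ac], of 1] s \<phi>e[of 1] \<phi>0[of s] k0 by simp
  then have 2: "integral {s..1} (\<lambda>r. F r * \<phi> r) + integral {s..1} (\<lambda>r. \<Phi> r * k r) = 0"
    using i6 by (simp add: Henstock_Kurzweil_Integration.integral_add)
  have "integral {s..1} (\<lambda>r. (k r)\<^sup>2) = integral {s..1} (\<lambda>r. (p r * k r + \<Phi> r * k r) - m * k r)"
    by (intro integral_cong) (simp add: k_def power2_eq_square algebra_simps)
  also have "\<dots> = (integral {s..1} (\<lambda>r. p r * k r) + integral {s..1} (\<lambda>r. \<Phi> r * k r)) - m * integral {s..1} k"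
  proof -
    note I = set_lebesgue_integral_eq_integral(1)[OF i1] i6(2) set_lebesgue_integral_eq_integral(1)[OF k1]
    show ?thesis
      unfolding Henstock_Kurzweil_Integration.integral_diff[OF integrable_add[OF I(1,2)] integrable_on_mult_right[OF I(3)]]
        Henstock_Kurzweil_Integration.integral_add[OF I(1,2)] by simp
  qed
  also have "\<dots> = 0" using 1 2 k0 by simp
  finally obtain N' where "negligible N'" "\<And>r. r \<in> {s..1} - N' \<Longrightarrow> k r = 0"
    using integral_square_eq_0D[OF k2] by blast
  then show thesis
    by (intro that[of N' m]) (auto simp: k_def p_def \<Phi>_def algebra_simps)
qed

section \<open>Continuous differentiability on (0,1]\<close>

text \<open>Dividing the flux by the nonvanishing weight \<open>r powr (M - 1)\<close> gives a
  continuous version \<open>g\<close> of \<open>w\<close>. Since \<open>\<psi>\<close> is a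
  primitive of \<open>w\<close>, hence of \<open>g\<close>, the fundamental theorem applies.\<close>

lemma weak_solution_local_C1:
  fixes a b \<psi> w :: "real \<Rightarrow> real"
  assumes sol: "weak_solution M b \<nu> \<psi>" and w: "w \<in> L2 M" "has_weak_derivative \<psi> w"
    and a: "a \<in> borel_measurable lebesgue" "\<And>r. \<bar>a r\<bar> \<le> A"
    and N: "negligible N" "\<And>r. r \<in> {0<..1} - N \<Longrightarrow> b r = a r" and s: "0 < s" "s < 1"
  defines "F \<equiv> \<lambda>r. r powr (M - 1) * (a r * \<psi> r) + \<nu> * (r powr (M - 3) * \<psi> r)"
  obtains g N' where "continuous_on {s..1} g" "negligible N'" "\<And>r. r \<in> {s..1} - N' \<Longrightarrow> w r = g r"
    "\<And>r. r \<in> {s..1} \<Longrightarrow> (\<psi> has_real_derivative g r) (at r within {s..1})"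
    "has_ac_derivative (\<lambda>r. r powr (M - 1) * g r) (\<lambda>r. - F r) s 1"
proof -
  have \<psi>c: "continuous_on {0<..1} \<psi>"
    using sol by (auto simp: weak_solution_def H_0_def H1_0_def H1_def)
  then have \<psi>s: "continuous_on {s..1} \<psi>" by (rule continuous_on_subset) (use s in auto)
  obtain c N' where N': "negligible N'" "\<And>r. r \<in> {s..1} - N' \<Longrightarrow> r powr (M - 1) * w r = c - integral {s..r} F"
    using weak_solution_flux[OF sol w a N s, folded F_def] by blast
  have Fi: "F absolutely_integrable_on {s..1}"
    unfolding F_def by (rule source_absolutely_integrable[OF a \<psi>c s(1)])
  define P where "P = (\<lambda>r. c - integral {s..r} F)"
  define g where "g = (\<lambda>r. r powr (1 - M) * P r)"
  have Pac: "has_ac_derivative P (\<lambda>r. - F r) s 1"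
    by (rule has_ac_derivativeI) (use set_integrable_mult_right[of "-1" lebesgue _ F] Fi in \<open>auto simp: P_def\<close>)
  have Pg: "r powr (M - 1) * g r = P r" if "0 < r" for r
    using that by (simp add: g_def flip: mult.assoc powr_add)
  have wg: "w r = g r" if "r \<in> {s..1} - N'" for r
  proof -
    have "r powr (M - 1) * w r = r powr (M - 1) * g r" using N'(2)[OF that] Pg[of r] s that by (simp add: P_def)
    then show ?thesis using s that by simp
  qed
  have gc: "continuous_on {s..1} g"
    unfolding g_def using s by (auto intro!: continuous_intros has_ac_derivative_continuous_on[OF Pac])
  define G where "G = (\<lambda>t. \<psi> s + integral {s..t} g)"
  have Gc: "continuous_on {s..1} G"
    unfolding G_def by (intro continuous_intros indefinite_integral_continuous_1 integrable_continuous_real gc)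
  have eq: "\<psi> t = G t" if "t \<in> {s..<1}" for t
  proof -
    have "\<psi> t - \<psi> s = integral {s..t} w"
      by (rule weak_derivative_diff_eq[OF w(2)]) (use s that in \<open>auto intro: continuous_on_subset[OF \<psi>c]\<close>)
    also have "\<dots> = integral {s..t} g"
      by (rule integral_spike[OF N'(1)]) (use wg that in auto)
    finally show ?thesis by (simp add: G_def)
  qed
  \<comment> \<open>The weak derivative determines increments of \<open>\<psi>\<close> only inside
    the open interval; the value at 1 follows by continuity of both sides.\<close>
  have eq': "\<psi> t = G t" if "t \<in> {s..1}" for t
  proof -
    have cl: "closure {s..<1} = {s..1}" using s by simp
    have "continuous_on (closure {s..<1}) (\<lambda>t. \<psi> t - G t)" unfolding cl by (intro continuous_intros \<psi>s Gc)
    then have "\<psi> t - G t = 0"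
    proof (rule continuous_constant_on_closure)
      show "\<psi> x - G x = 0" if "x \<in> {s..<1}" for x using eq[OF that] by simp
      show "t \<in> closure {s..<1}" unfolding cl by (rule that)
    qed
    then show ?thesis by simp
  qed
  show thesis
  proof (rule that[of g N'])
    show "(\<psi> has_real_derivative g r) (at r within {s..1})" if "r \<in> {s..1}" for r
    proof -
      have "(G has_real_derivative g r) (at r within {s..1})"
        unfolding G_def by (rule DERIV_cong[OF DERIV_add[OF DERIV_const integral_has_real_derivative[OF gc that]]]) simp
      then show ?thesis
        by (rule has_field_derivative_transform_within[of _ _ _ _ 1]) (use eq' that in auto)
    qed
    show "has_ac_derivative (\<lambda>r. r powr (M - 1) * g r) (\<lambda>r. - F r) s 1"
      by (rule has_ac_derivative_cong[OF Pac, of "{}"]) (use s Pg in auto)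
  qed (use gc N' wg in auto)
qed


text \<open>Serves to glue the derivatives found on \<open>{s..1}\<close> for different
  \<open>s\<close>: both restrict to a common nondegenerate interval, where the derivative is
  unique.\<close>

lemma has_real_derivative_within_Icc_unique:
  fixes f :: "real \<Rightarrow> real"
  assumes "(f has_real_derivative D) (at x within {a..b})" "(f has_real_derivative E) (at x within {c..b})"
    and "x \<in> {max a c..b}" "max a c < b"
  shows "D = E"
proof -
  let ?S = "{max a c..b}"
  have "(f has_real_derivative D) (at x within ?S)" "(f has_real_derivative E) (at x within ?S)"
    using assms(1,2) by (auto elim: DERIV_subset)
  then show ?thesis
    using assms(3,4) vector_derivative_unique_within[of x ?S f D E]
    by (simp add: has_real_derivative_iff_has_vector_derivative trivial_limit_within islimpt_Icc)
qed

text \<open>Collects what the decay analysis needs: a derivative glued from the local ones, the flux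
  equation on every \<open>{s..1}\<close>, and an energy bound uniform in \<open>s\<close>.\<close>

lemma weak_solution_C1:
  fixes b \<psi> :: "real \<Rightarrow> real"
  assumes sol: "weak_solution M b \<nu> \<psi>" and b: "b \<in> Linfinity"
  obtains a A \<psi>' K where "\<And>r. \<bar>a r\<bar> \<le> A"
    "\<And>r. r \<in> {0<..1} \<Longrightarrow> (\<psi> has_real_derivative \<psi>' r) (at r within {0<..1})"
    "continuous_on {0<..1} \<psi>'"
    "\<And>s. 0 < s \<Longrightarrow> s < 1 \<Longrightarrow> has_ac_derivative (\<lambda>r. r powr (M - 1) * \<psi>' r)
        (\<lambda>r. - (r powr (M - 1) * (a r * \<psi> r) + \<nu> * (r powr (M - 3) * \<psi> r))) s 1"
    "\<And>s. 0 < s \<Longrightarrow> s < 1 \<Longrightarrow> integral {s..1} (\<lambda>r. r powr (M - 1) * (\<psi>' r)\<^sup>2 + r powr (M - 3) * (\<psi> r)\<^sup>2) \<le> K"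
proof -
  obtain a A N where a: "a \<in> borel_measurable lebesgue" "\<And>r. \<bar>a r\<bar> \<le> A"
    and N: "negligible N" "\<And>r. r \<in> {0<..1} - N \<Longrightarrow> b r = a r"
    using Linfinity_bounded_version[OF b] by metis
  obtain w where w: "w \<in> L2 M" "has_weak_derivative \<psi> w"
    using sol by (auto simp: weak_solution_def H_0_def H1_0_def H1_def)
  have \<psi>c: "continuous_on {0<..1} \<psi>" and hardy: "integrable unit_interval_measure (\<lambda>r. r powr (M - 3) * (\<psi> r)\<^sup>2)"
    using sol by (auto simp: weak_solution_def H_0_def H1_0_def H1_def L_Hardy_def)
  define F where "F = (\<lambda>r. r powr (M - 1) * (a r * \<psi> r) + \<nu> * (r powr (M - 3) * \<psi> r))"
  define Q where "Q = (\<lambda>s g. continuous_on {s..1} g \<and> (\<exists>N'. negligible N' \<and> (\<forall>r\<in>{s..1} - N'. w r = g r)) \<and>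
    (\<forall>r\<in>{s..1}. (\<psi> has_real_derivative g r) (at r within {s..1})) \<and>
    has_ac_derivative (\<lambda>r. r powr (M - 1) * g r) (\<lambda>r. - F r) s 1)"
  have "\<exists>g. Q s g" if "0 < s" "s < 1" for s
    unfolding Q_def F_def by (rule weak_solution_local_C1[OF sol w a N that])
      (assumption, rule exI, intro conjI, assumption, blast, blast, assumption)
  then obtain g where g: "\<And>s. 0 < s \<Longrightarrow> s < 1 \<Longrightarrow> Q s (g s)" by metis
  \<comment> \<open>Any left end point strictly between 0 and \<open>r\<close> gives the same value;
    half of \<open>r\<close> also works for \<open>r = 1\<close>.\<close>
  define \<psi>' where "\<psi>' = (\<lambda>r. g (r / 2) r)"
  have \<psi>'_eq: "\<psi>' r = g s r" if "0 < s" "s < 1" "r \<in> {s..1}" for r s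
    unfolding \<psi>'_def
    by (rule has_real_derivative_within_Icc_unique[of \<psi> _ r "r / 2" 1 _ s])
      (use that g[of s] g[of "r / 2"] in \<open>auto simp: Q_def\<close>)
  \<comment> \<open>Near \<open>r\<close> the two sets coincide, so derivatives and continuity on
    the compact interval carry over to \<open>{0<..1}\<close>.\<close>
  have within: "at r within {r / 2..1} = at r within {0<..1}" if "r \<in> {0<..1}" for r :: real
    by (rule at_within_nhd[of _ "{r / 2<..}"]) (use that in auto)
  have 1: "(\<psi> has_real_derivative \<psi>' r) (at r within {0<..1})" if "r \<in> {0<..1}" for r
  proof -
    have "(\<psi> has_real_derivative g (r / 2) r) (at r within {r / 2..1})"
      using g[of "r / 2"] that by (auto simp: Q_def)
    then show ?thesis unfolding within[OF that] \<psi>'_def .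
  qed
  have \<psi>'s: "continuous_on {s..1} \<psi>'" if "0 < s" "s < 1" for s
    by (rule continuous_on_eq[of _ "g s"]) (use g[OF that] \<psi>'_eq[OF that] in \<open>auto simp: Q_def\<close>)
  have 2: "continuous_on {0<..1} \<psi>'"
    unfolding continuous_on_eq_continuous_within
  proof
    fix r :: real assume r: "r \<in> {0<..1}"
    then have "continuous (at r within {r / 2..1}) \<psi>'"
      using \<psi>'s[of "r / 2"] by (auto simp: continuous_on_eq_continuous_within)
    then show "continuous (at r within {0<..1}) \<psi>'" unfolding continuous_within within[OF r] .
  qed
  have 3: "has_ac_derivative (\<lambda>r. r powr (M - 1) * \<psi>' r) (\<lambda>r. - F r) s 1" if "0 < s" "s < 1" for s
    by (rule has_ac_derivative_cong[of _ _ _ _ "{}"]) (use g[OF that] \<psi>'_eq[OF that] in \<open>auto simp: Q_def\<close>)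
  have energy: "integral {s..1} h \<le> (LINT r|unit_interval_measure. h r) \<and> h integrable_on {s..1}"
    if "integrable unit_interval_measure h" "0 < s" "\<And>r. 0 \<le> h r" for s and h :: "real \<Rightarrow> real"
  proof -
    have hi: "h absolutely_integrable_on {0<..<1}"
      using that by (simp add: set_integrable_def integrable_restrict_space)
    then have hs: "h absolutely_integrable_on {s<..<1}"
      by (rule set_integrable_subset) (use that in auto)
    have hs': "h integrable_on {s<..<1}" by (rule set_lebesgue_integral_eq_integral(1)[OF hs])
    have "integral {s..1} h = integral {s<..<1} h"
      by (rule integral_open_interval_real)
    also have "\<dots> \<le> integral {0<..<1} h"
      by (rule integral_subset_le) (use that hs' hi in \<open>auto intro: set_lebesgue_integral_eq_integral(1)\<close>)
    also have "\<dots> = (LINT r|unit_interval_measure. h r)"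
      by (rule lebesgue_integral_eq_integral[symmetric]) (use that in auto)
    finally show ?thesis using hs' by (simp add: integrable_on_open_interval_real)
  qed
  have wi: "integrable unit_interval_measure (\<lambda>r. r powr (M - 1) * (w r)\<^sup>2)" using w by (simp add: L2_def)
  \<comment> \<open>Both integrals are finite because \<open>w\<close> is in \<open>L2 M\<close> and
    \<open>\<psi>\<close> in \<open>L_Hardy M\<close>; by nonnegativity they bound the integrals
    over every \<open>{s..1}\<close>.\<close>
  define K where "K = (LINT r|unit_interval_measure. r powr (M - 1) * (w r)\<^sup>2) +
    (LINT r|unit_interval_measure. r powr (M - 3) * (\<psi> r)\<^sup>2)"
  have 4: "integral {s..1} (\<lambda>r. r powr (M - 1) * (\<psi>' r)\<^sup>2 + r powr (M - 3) * (\<psi> r)\<^sup>2) \<le> K" if s: "0 < s" "s < 1" for s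
  proof -
    obtain N' where N': "negligible N'" "\<And>r. r \<in> {s..1} - N' \<Longrightarrow> w r = g s r"
      using g[OF s] unfolding Q_def by blast
    have "integral {s..1} (\<lambda>r. r powr (M - 1) * (\<psi>' r)\<^sup>2 + r powr (M - 3) * (\<psi> r)\<^sup>2) =
      integral {s..1} (\<lambda>r. r powr (M - 1) * (w r)\<^sup>2 + r powr (M - 3) * (\<psi> r)\<^sup>2)"
      by (rule integral_spike[OF N'(1)]) (use N'(2) \<psi>'_eq[OF s] in auto)
    also have "\<dots> = integral {s..1} (\<lambda>r. r powr (M - 1) * (w r)\<^sup>2) + integral {s..1} (\<lambda>r. r powr (M - 3) * (\<psi> r)\<^sup>2)"
      using energy[OF wi s(1)] energy[OF hardy s(1)] by (intro Henstock_Kurzweil_Integration.integral_add) auto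
    also have "\<dots> \<le> K"
      unfolding K_def using energy[OF wi s(1)] energy[OF hardy s(1)] by (intro add_mono) auto
    finally show ?thesis .
  qed
  show thesis
    using that[OF a(2) 1 2 3[unfolded F_def] 4] .
qed

section \<open>Decay at the origin\<close>

text \<open>These facts stand in for the weak formulation. That \<open>K\<close> is independent of
  \<open>s\<close> expresses finite energy up to the origin.\<close>

locale radial_solution =
  fixes M \<nu> A K :: real and a \<psi> \<psi>' :: "real \<Rightarrow> real"
  assumes M: "2 \<le> M" and \<nu>: "\<nu> < 0"
    and a_bound: "\<And>r. \<bar>a r\<bar> \<le> A"
    and deriv_\<psi>: "\<And>r. r \<in> {0<..1} \<Longrightarrow> (\<psi> has_real_derivative \<psi>' r) (at r within {0<..1})"
    and cont_\<psi>': "continuous_on {0<..1} \<psi>'"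
    and flux: "\<And>s. 0 < s \<Longrightarrow> s < 1 \<Longrightarrow> has_ac_derivative (\<lambda>r. r powr (M - 1) * \<psi>' r)
        (\<lambda>r. - (r powr (M - 1) * (a r * \<psi> r) + \<nu> * (r powr (M - 3) * \<psi> r))) s 1"
    and energy: "\<And>s. 0 < s \<Longrightarrow> s < 1 \<Longrightarrow>
        integral {s..1} (\<lambda>r. r powr (M - 1) * (\<psi>' r)\<^sup>2 + r powr (M - 3) * (\<psi> r)\<^sup>2) \<le> K"
begin

definition \<theta> :: real where "\<theta> = (2 - M + sqrt ((M - 2)\<^sup>2 - 4 * \<nu>)) / 2"

text \<open>For \<open>a = 0\<close> the equation is solved by \<open>r powr \<theta>\<close> and
  \<open>r powr (- \<kappa>)\<close>: \<open>\<theta>\<close> and \<open>- \<kappa>\<close> are the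
  two roots of \<open>\<tau> * (\<tau> + M - 2) = - \<nu>\<close>.\<close>

definition \<kappa> :: real where "\<kappa> = \<theta> + M - 2"

text \<open>For \<open>r > 0\<close> this is the Wronskian of \<open>r powr \<tau>\<close> and
  \<open>\<psi>\<close>, weighted by \<open>r powr (M - 1)\<close>. The roots
  \<open>\<theta>\<close> and \<open>- \<kappa>\<close> yield the quantities in the two first-order
  identities.\<close>

definition T :: "real \<Rightarrow> real \<Rightarrow> real" where
  "T \<tau> r = r powr \<tau> * (r powr (M - 1) * \<psi>' r) - \<tau> * (r powr (\<tau> + M - 2) * \<psi> r)"

lemma \<theta>_pos: "0 < \<theta>"
proof -
  have "sqrt ((M - 2)\<^sup>2) < sqrt ((M - 2)\<^sup>2 - 4 * \<nu>)" using \<nu> by (intro real_sqrt_less_mono) auto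
  then show ?thesis using M by (simp add: \<theta>_def)
qed

lemma \<kappa>_ge: "\<theta> \<le> \<kappa>" using M by (simp add: \<kappa>_def)

lemma \<kappa>_pos: "0 < \<kappa>" using \<theta>_pos \<kappa>_ge by simp

lemma \<theta>_\<kappa>: "\<theta> * \<kappa> = - \<nu>"
proof -
  have "(sqrt ((M - 2)\<^sup>2 - 4 * \<nu>))\<^sup>2 = (M - 2)\<^sup>2 - 4 * \<nu>"
    using \<nu> zero_le_power2[of "M - 2"] by (intro real_sqrt_pow2) linarith
  then show ?thesis by (simp add: \<kappa>_def \<theta>_def field_simps power2_eq_square)
qed

lemma A_nonneg: "0 \<le> A" using a_bound[of 0] by linarith

lemma cont_\<psi>: "continuous_on {0<..1} \<psi>"
  using deriv_\<psi> by (meson DERIV_continuous continuous_on_eq_continuous_within)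

lemma \<psi>_local: 
  assumes "0 < s"
  shows "continuous_on {s..1} \<psi>" "continuous_on {s..1} \<psi>'" "has_ac_derivative \<psi> \<psi>' s 1"
proof -
  show 1: "continuous_on {s..1} \<psi>" "continuous_on {s..1} \<psi>'"
    using assms by (auto intro: continuous_on_subset[OF cont_\<psi>] continuous_on_subset[OF cont_\<psi>'])
  show "has_ac_derivative \<psi> \<psi>' s 1"
    by (rule has_ac_derivative_C1[OF 1(2)]) (use assms in \<open>auto intro: DERIV_subset[OF deriv_\<psi>]\<close>)
qed

lemma powr_ac:
  assumes "0 < s"
  shows "has_ac_derivative (\<lambda>r. r powr \<alpha>) (\<lambda>r. \<alpha> * r powr (\<alpha> - 1)) s t"
  by (rule has_ac_derivative_C1) (use assms in \<open>auto intro!: continuous_intros derivative_eq_intros\<close>)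

text \<open>For a root \<open>\<tau>\<close> of \<open>\<tau> (\<tau> + M - 2) = - \<nu>\<close> the Hardy term cancels.\<close>

lemma T_ac:
  assumes s: "0 < s" "s < 1" and \<tau>: "\<tau> * (\<tau> + M - 2) = - \<nu>"
  shows "has_ac_derivative (T \<tau>) (\<lambda>r. - (a r * (r powr (\<tau> + M - 1) * \<psi> r))) s 1"
proof (rule has_ac_derivative_cong[OF has_ac_derivative_add[OF
      has_ac_derivative_mult[OF powr_ac[OF s(1), of \<tau>] flux[OF s]]
      has_ac_derivative_cmult[OF has_ac_derivative_mult[OF powr_ac[OF s(1), of "\<tau> + M - 2"] \<psi>_local(3)[OF s(1)]], of "- \<tau>"]], of "{}"])
  fix r assume r: "r \<in> {s..1} - {}"
  \<comment> \<open>All powers of \<open>r\<close> become monomials times the common factor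
    \<open>X\<close>, which reduces the cancellation of the Hardy term to algebra.\<close>
  define X where "X = r powr (\<tau> + M - 3)"
  have *: "r powr (\<tau> - 1) * r powr (M - 1) = r * X" "r powr \<tau> * r powr (M - 1) = r\<^sup>2 * X" "r powr \<tau> * r powr (M - 3) = X"
    "r powr (\<tau> + M - 2) = r * X" "r powr (\<tau> + M - 1) = r\<^sup>2 * X" "r powr (\<tau> + M - 2 - 1) = X"
    using r s powr_mult_base[of r "\<tau> + M - 3"] powr_mult_base[of r "\<tau> + M - 2"] unfolding X_def
    by (auto simp: power2_eq_square algebra_simps simp flip: powr_add)
  have "\<tau> * r powr (\<tau> - 1) * (r powr (M - 1) * \<psi>' r) +
      r powr \<tau> * - (r powr (M - 1) * (a r * \<psi> r) + \<nu> * (r powr (M - 3) * \<psi> r)) +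
      - \<tau> * ((\<tau> + M - 2) * r powr (\<tau> + M - 2 - 1) * \<psi> r + r powr (\<tau> + M - 2) * \<psi>' r) =
    \<tau> * (r powr (\<tau> - 1) * r powr (M - 1)) * \<psi>' r - (r powr \<tau> * r powr (M - 1)) * (a r * \<psi> r)
      - \<nu> * (r powr \<tau> * r powr (M - 3)) * \<psi> r - (\<tau> * (\<tau> + M - 2)) * r powr (\<tau> + M - 2 - 1) * \<psi> r
      - \<tau> * r powr (\<tau> + M - 2) * \<psi>' r"
    by (simp add: algebra_simps)
  also have "\<dots> = - (a r * (r powr (\<tau> + M - 1) * \<psi> r))"
    unfolding * \<tau> by (simp add: algebra_simps)
  finally show "- (a r * (r powr (\<tau> + M - 1) * \<psi> r)) =
      \<tau> * r powr (\<tau> - 1) * (r powr (M - 1) * \<psi>' r) +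
      r powr \<tau> * - (r powr (M - 1) * (a r * \<psi> r) + \<nu> * (r powr (M - 3) * \<psi> r)) +
      - \<tau> * ((\<tau> + M - 2) * r powr (\<tau> + M - 2 - 1) * \<psi> r + r powr (\<tau> + M - 2) * \<psi>' r)" by simp
qed (auto simp: T_def)

lemma T_diff_le:
  assumes s: "0 < s" "s \<le> t" "t \<le> 1" "s < 1" and \<tau>: "\<tau> * (\<tau> + M - 2) = - \<nu>"
    and B: "\<And>r. r \<in> {s..t} \<Longrightarrow> r powr (\<tau> + M - 1) * \<bar>\<psi> r\<bar> \<le> B"
  shows "\<bar>T \<tau> t - T \<tau> s\<bar> \<le> A * B * (t - s)"
proof -
  note ac = T_ac[OF s(1,4) \<tau>]
  let ?f = "\<lambda>r. - (a r * (r powr (\<tau> + M - 1) * \<psi> r))"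
  have "?f integrable_on {s..t}"
    using has_ac_derivativeD(2)[OF has_ac_derivative_subinterval[OF ac order_refl s(3)]] .
  then have "norm (integral {s..t} ?f) \<le> integral {s..t} (\<lambda>_. A * B)"
  proof (rule Henstock_Kurzweil_Integration.integral_norm_bound_integral)
    fix r assume r: "r \<in> {s..t}"
    have "\<bar>a r\<bar> * (r powr (\<tau> + M - 1) * \<bar>\<psi> r\<bar>) \<le> A * B"
      by (rule mult_mono[OF a_bound B[OF r] A_nonneg]) simp
    then show "norm (?f r) \<le> A * B" by (simp add: abs_mult)
  qed auto
  then show ?thesis
    using has_ac_derivative_diff_eq[OF ac order_refl s(2,3)] s by (simp add: mult_ac)
qed

section \<open>Consequences of finite energy\<close>

lemma energy_nonneg: "0 \<le> K"
proof -
  have "0 \<le> integral {1/2..1} (\<lambda>r. r powr (M - 1) * (\<psi>' r)\<^sup>2 + r powr (M - 3) * (\<psi> r)\<^sup>2)"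
    by (intro integral_nonneg integrable_continuous_real continuous_intros \<psi>_local) auto
  then show ?thesis using energy[of "1/2"] by simp
qed

text \<open>The derivative of \<open>r powr (M - 2) * (\<psi> r)\<^sup>2\<close> is at most
  \<open>M - 1\<close> times the energy density in absolute value, because
  \<open>2 * \<bar>x * y\<bar> \<le> x\<^sup>2 + y\<^sup>2\<close> with
  \<open>x = r * \<psi>' r\<close> and \<open>y = \<psi> r\<close>. Integrating up to 1 bounds the
  quantity uniformly.\<close>

lemma \<psi>_initial_bound:
  obtains C where "\<And>r. r \<in> {0<..1} \<Longrightarrow> \<bar>\<psi> r\<bar> \<le> C * r powr (- (M - 2) / 2)"
proof -
  let ?E = "\<lambda>r. r powr (M - 2) * (\<psi> r * \<psi> r)"
  let ?h = "\<lambda>r. r powr (M - 1) * (\<psi>' r)\<^sup>2 + r powr (M - 3) * (\<psi> r)\<^sup>2"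
  define D where "D = ?E 1 + (M - 1) * K"
  have D: "?E s \<le> D" if s: "0 < s" "s < 1" for s
  proof -
    note ac = has_ac_derivative_mult[OF powr_ac[OF s(1), of "M - 2" 1] has_ac_derivative_mult[OF \<psi>_local(3) \<psi>_local(3)], OF s(1) s(1)]
    let ?e = "\<lambda>r. (M - 2) * r powr (M - 2 - 1) * (\<psi> r * \<psi> r) + r powr (M - 2) * (\<psi>' r * \<psi> r + \<psi> r * \<psi>' r)"
    have h: "?h integrable_on {s..1}"
      by (intro integrable_continuous_real continuous_intros \<psi>_local) (use s in auto)
    have "norm (integral {s..1} ?e) \<le> integral {s..1} (\<lambda>r. (M - 1) * ?h r)"
    proof (rule Henstock_Kurzweil_Integration.integral_norm_bound_integral)
      show "?e integrable_on {s..1}" by (rule has_ac_derivativeD(2)[OF ac])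
      show "(\<lambda>r. (M - 1) * ?h r) integrable_on {s..1}" by (rule integrable_on_mult_right[OF h])
      fix r assume r: "r \<in> {s..1}"
      define X where "X = r powr (M - 3)"
      have X: "r powr (M - 2 - 1) = X" "r powr (M - 2) = r * X" "r powr (M - 1) = r\<^sup>2 * X" "0 \<le> X"
        using r s powr_mult_base[of r "M - 3"] powr_mult_base[of r "M - 2"] unfolding X_def
        by (auto simp: power2_eq_square algebra_simps)
      have "2 * \<bar>r * \<psi>' r\<bar> * \<bar>\<psi> r\<bar> \<le> (r * \<psi>' r)\<^sup>2 + (\<psi> r)\<^sup>2"
        using sum_squares_bound[of "\<bar>r * \<psi>' r\<bar>" "\<bar>\<psi> r\<bar>"] by simp
      then have 1: "\<bar>2 * (r * \<psi>' r * \<psi> r)\<bar> \<le> (r * \<psi>' r)\<^sup>2 + (\<psi> r)\<^sup>2" by (simp add: abs_mult)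
      have 2: "\<bar>(M - 2) * (\<psi> r)\<^sup>2\<bar> \<le> (M - 2) * ((r * \<psi>' r)\<^sup>2 + (\<psi> r)\<^sup>2)"
        using M by (simp add: abs_mult mult_left_mono)
      have "\<bar>(M - 2) * (\<psi> r)\<^sup>2 + 2 * (r * \<psi>' r * \<psi> r)\<bar> \<le> (M - 2) * ((r * \<psi>' r)\<^sup>2 + (\<psi> r)\<^sup>2) + ((r * \<psi>' r)\<^sup>2 + (\<psi> r)\<^sup>2)"
        by (rule order_trans[OF abs_triangle_ineq add_mono[OF 2 1]])
      then have "X * \<bar>(M - 2) * (\<psi> r)\<^sup>2 + 2 * (r * \<psi>' r * \<psi> r)\<bar> \<le> X * ((M - 1) * ((r * \<psi>' r)\<^sup>2 + (\<psi> r)\<^sup>2))"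
        using X(4) by (intro mult_left_mono) (auto simp: algebra_simps)
      moreover have e: "?e r = X * ((M - 2) * (\<psi> r)\<^sup>2 + 2 * (r * \<psi>' r * \<psi> r))"
        unfolding X by (simp add: algebra_simps power2_eq_square)
      moreover have h: "(M - 1) * ?h r = X * ((M - 1) * ((r * \<psi>' r)\<^sup>2 + (\<psi> r)\<^sup>2))"
        unfolding X by (simp add: algebra_simps power2_eq_square X_def)
      ultimately show "norm (?e r) \<le> (M - 1) * ?h r"
        unfolding e h real_norm_def abs_mult using X(4) by simp
    qed
    also have "\<dots> \<le> (M - 1) * K"
      using energy[OF s] M by (simp add: mult_left_mono)
    finally show ?thesis
      using has_ac_derivativeD(3)[OF ac, of 1] s unfolding D_def by simp
  qed
  have D1: "?E 1 \<le> D" using M energy_nonneg by (simp add: D_def)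
  have D': "?E r \<le> D" if "r \<in> {0<..1}" for r
    using D[of r] D1 that by (cases "r = 1") auto
  have "\<bar>\<psi> r\<bar> \<le> sqrt D * r powr (- (M - 2) / 2)" if r: "r \<in> {0<..1}" for r
  proof -
    have "(\<psi> r)\<^sup>2 = ?E r * r powr (- (M - 2))"
      using r by (simp add: power2_eq_square flip: powr_add)
    also have "\<dots> \<le> D * r powr (- (M - 2))" by (rule mult_right_mono[OF D'[OF r]]) simp
    finally have "\<bar>\<psi> r\<bar> \<le> sqrt (D * r powr (- (M - 2)))" by (simp add: real_le_rsqrt)
    also have "\<dots> = sqrt D * r powr (- (M - 2) / 2)"
      using r by (simp add: real_sqrt_mult powr_half_sqrt[symmetric] powr_powr)
    finally show ?thesis .
  qed
  then show thesis by (rule that)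
qed

lemma T_\<theta>_eq: "0 < r \<Longrightarrow> T \<theta> r = r powr \<kappa> * (r * \<psi>' r - \<theta> * \<psi> r)"
proof -
  assume r: "0 < r"
  have *: "r powr \<theta> * r powr (M - 1) = r * r powr \<kappa>" "r powr (\<theta> + M - 2) = r powr \<kappa>"
    using r powr_mult_base[of r \<kappa>] by (auto simp: \<kappa>_def algebra_simps simp flip: powr_add)
  show ?thesis unfolding T_def mult.assoc[symmetric] * by (simp add: algebra_simps *)
qed

lemma T_\<kappa>_eq: "0 < r \<Longrightarrow> T (- \<kappa>) r = r powr (- \<theta>) * (r * \<psi>' r + \<kappa> * \<psi> r)"
proof -
  assume r: "0 < r"
  have *: "r powr (- \<kappa>) * r powr (M - 1) = r * r powr (- \<theta>)" "r powr (- \<kappa> + M - 2) = r powr (- \<theta>)"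
    using r powr_mult_base[of r "- \<theta>"] by (auto simp: \<kappa>_def algebra_simps simp flip: powr_add)
  show ?thesis unfolding T_def mult.assoc[symmetric] * by (simp add: algebra_simps *)
qed

text \<open>Otherwise the energy density would dominate a multiple of \<open>1 / r\<close> near \<open>0\<close>.\<close>

lemma T_\<theta>_small:
  assumes "0 < \<epsilon>" "0 < \<delta>" "\<delta> \<le> 1"
  obtains s where "0 < s" "s < \<delta>" "\<bar>T \<theta> s\<bar> < \<epsilon>"
proof (rule ccontr)
  assume contra: "\<not> thesis"
  note witness = that
  have ge: "\<epsilon> \<le> \<bar>T \<theta> s\<bar>" if "0 < s" "s < \<delta>" for s
    using witness[of s] contra that by force
  let ?h = "\<lambda>r. r powr (M - 1) * (\<psi>' r)\<^sup>2 + r powr (M - 3) * (\<psi> r)\<^sup>2"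
  \<comment> \<open>From \<open>(x - y)\<^sup>2 \<le> 2 * (x\<^sup>2 + y\<^sup>2)\<close> with
    \<open>y = \<theta> * \<psi> r\<close>; \<open>c\<close> dominates both resulting
    coefficients.\<close>
  define c where "c = 2 * (1 + \<theta>\<^sup>2)"
  \<comment> \<open>Halving keeps the closed interval ending at \<open>d\<close> below
    \<open>\<delta>\<close>, where the assumed lower bound holds, and below 1.\<close>
  define d where "d = \<delta> / 2"
  have d: "0 < d" "d < \<delta>" "d < 1" using assms by (auto simp: d_def)
  have pt: "\<epsilon>\<^sup>2 * (1 / r) \<le> c * ?h r" if r: "0 < r" "r \<le> d" for r
  proof -
    define X where "X = r powr (M - 3)"
    have X: "r powr (M - 1) = r\<^sup>2 * X" "0 \<le> X"
      using r powr_mult_base[of r "M - 3"] powr_mult_base[of r "M - 2"] unfolding X_def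
      by (auto simp: power2_eq_square algebra_simps)
    have h: "?h r = X * ((r * \<psi>' r)\<^sup>2 + (\<psi> r)\<^sup>2)"
      unfolding X by (simp add: algebra_simps power2_eq_square X_def)
    \<comment> \<open>\<open>2 * \<kappa> = (\<kappa> + \<theta> + 1) + (M - 3)\<close>, and the
      first exponent is at least 1, so that power is at most \<open>r\<close> when
      \<open>r \<le> 1\<close>.\<close>
    have "r powr \<kappa> * r powr \<kappa> = r powr (\<kappa> + \<theta> + 1) * X"
      using r by (simp add: X_def \<kappa>_def algebra_simps flip: powr_add)
    also have "\<dots> \<le> r powr 1 * X"
      by (rule mult_right_mono[OF powr_mono']) (use r d \<theta>_pos \<kappa>_pos X in auto)
    finally have p: "(r powr \<kappa>)\<^sup>2 \<le> r * X" using r by (simp add: power2_eq_square)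
    have "(r * \<psi>' r - \<theta> * \<psi> r)\<^sup>2 + (r * \<psi>' r + \<theta> * \<psi> r)\<^sup>2 = 2 * ((r * \<psi>' r)\<^sup>2 + \<theta>\<^sup>2 * (\<psi> r)\<^sup>2)"
      by (simp add: power2_eq_square algebra_simps)
    then have "(r * \<psi>' r - \<theta> * \<psi> r)\<^sup>2 \<le> 2 * ((r * \<psi>' r)\<^sup>2 + \<theta>\<^sup>2 * (\<psi> r)\<^sup>2)"
      using zero_le_power2[of "r * \<psi>' r + \<theta> * \<psi> r"] by linarith
    also have "\<dots> \<le> c * ((r * \<psi>' r)\<^sup>2 + (\<psi> r)\<^sup>2)"
      by (simp add: c_def algebra_simps)
    finally have q: "(r * \<psi>' r - \<theta> * \<psi> r)\<^sup>2 \<le> c * ((r * \<psi>' r)\<^sup>2 + (\<psi> r)\<^sup>2)" .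
    have "\<epsilon>\<^sup>2 \<le> \<bar>T \<theta> r\<bar>\<^sup>2" using ge[of r] r d assms by (intro power_mono) auto
    also have "\<dots> = (r powr \<kappa>)\<^sup>2 * (r * \<psi>' r - \<theta> * \<psi> r)\<^sup>2"
      by (simp add: T_\<theta>_eq[OF r(1)] power_mult_distrib)
    also have "\<dots> \<le> (r * X) * (c * ((r * \<psi>' r)\<^sup>2 + (\<psi> r)\<^sup>2))"
      by (rule mult_mono[OF p q]) (use r X in auto)
    also have "\<dots> = c * ?h r * r" unfolding h by (simp add: algebra_simps)
    finally show ?thesis using r by (simp add: field_simps)
  qed
  \<comment> \<open>\<open>Z\<close> is the logarithmic length at which the lower bound reaches
    \<open>c * K + 1\<close>, more than the energy allows; \<open>x\<close> is chosen so that
    \<open>ln d - ln x = Z\<close>.\<close>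
  define Z where "Z = (c * K + 1) / \<epsilon>\<^sup>2"
  define x where "x = d * exp (- Z)"
  have c: "0 \<le> c" by (simp add: c_def)
  have Z: "0 \<le> Z" using c energy_nonneg by (simp add: Z_def)
  have x: "0 < x" "x \<le> d" using d Z by (auto simp: x_def)
  have "((\<lambda>r. 1 / r) has_integral (ln d - ln x)) {x..d}"
  proof (rule fundamental_theorem_of_calculus[OF x(2)])
    show "(ln has_vector_derivative 1 / r) (at r within {x..d})" if "r \<in> {x..d}" for r
      using that x by (auto intro!: derivative_eq_intros simp flip: has_real_derivative_iff_has_vector_derivative)
  qed
  then have ln_int: "((\<lambda>r. \<epsilon>\<^sup>2 * (1 / r)) has_integral \<epsilon>\<^sup>2 * (ln d - ln x)) {x..d}"
    by (rule has_integral_mult_right)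
  have hi: "?h integrable_on {x..1}" 
    by (intro integrable_continuous_real continuous_intros \<psi>_local) (use x in auto)
  have hi': "?h integrable_on {x..d}" by (rule integrable_subinterval_real[OF hi]) (use d in auto)
  have "\<epsilon>\<^sup>2 * (ln d - ln x) \<le> integral {x..d} (\<lambda>r. c * ?h r)"
    by (rule has_integral_le[OF ln_int integrable_integral[OF integrable_on_mult_right[OF hi']]]) (use pt x in auto)
  also have "\<dots> = c * integral {x..d} ?h" by simp
  also have "integral {x..d} ?h \<le> integral {x..1} ?h"
    by (rule integral_subset_le[OF _ hi' hi]) (use d in auto)
  also have "\<dots> \<le> K" using energy[of x] x d by auto
  finally have "\<epsilon>\<^sup>2 * (ln d - ln x) \<le> c * K" using c by (simp add: mult_left_mono)
  moreover have "ln d - ln x = Z" using d by (simp add: x_def ln_mult)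
  ultimately show False using assms(1) by (simp add: Z_def)
qed

section \<open>Bootstrapping the decay exponent\<close>

text \<open>The integral from \<open>r\<close> to 1 is estimated by supremum times length, so one
  power is gained rather than two, which suffices for the iteration. The lower bound on
  \<open>\<sigma>\<close> makes the powers in the integral from 0 increasing.\<close>

lemma bootstrap_step:
  assumes \<sigma>: "- (M - 2) / 2 \<le> \<sigma>" and C: "\<And>r. r \<in> {0<..1} \<Longrightarrow> \<bar>\<psi> r\<bar> \<le> C * r powr \<sigma>"
  defines "\<rho> \<equiv> min \<theta> (\<sigma> + 1)"
  obtains D where "\<And>r. r \<in> {0<..1} \<Longrightarrow> \<bar>\<psi> r\<bar> \<le> D * r powr \<rho>"
    "\<And>r. r \<in> {0<..1} \<Longrightarrow> \<bar>r * \<psi>' r\<bar> \<le> D * r powr \<rho>"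
proof -
  have C0: "0 \<le> C" using C[of 1] abs_ge_zero[of "\<psi> 1"] by simp
  have \<tau>1: "\<theta> * (\<theta> + M - 2) = - \<nu>" using \<theta>_\<kappa> by (simp add: \<kappa>_def)
  have \<tau>2: "- \<kappa> * (- \<kappa> + M - 2) = - \<nu>" using \<theta>_\<kappa> by (simp add: \<kappa>_def algebra_simps)
  have weighted: "r powr \<alpha> * \<bar>\<psi> r\<bar> \<le> C * r powr (\<alpha> + \<sigma>)" if "r \<in> {0<..1}" for r \<alpha>
    using mult_left_mono[OF C[OF that], of "r powr \<alpha>"] by (simp add: powr_add algebra_simps)
  have g: "\<bar>r * \<psi>' r - \<theta> * \<psi> r\<bar> \<le> A * C * r powr \<rho>" if r: "r \<in> {0<..1}" for r
  proof -
    \<comment> \<open>Points \<open>s\<close> near 0 with \<open>T \<theta> s\<close> below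
      \<open>\<epsilon>\<close> play the role of a zero boundary value at the origin;
      \<open>\<epsilon>\<close> is then removed.\<close>
    have "\<bar>T \<theta> r\<bar> \<le> A * C * r powr (\<kappa> + \<sigma> + 2) + \<epsilon>" if \<epsilon>: "0 < \<epsilon>" for \<epsilon>
    proof -
      obtain s where s: "0 < s" "s < r" "\<bar>T \<theta> s\<bar> < \<epsilon>" using T_\<theta>_small[OF \<epsilon>, of r] r by auto
      have "\<bar>T \<theta> r - T \<theta> s\<bar> \<le> A * (C * r powr (\<kappa> + \<sigma> + 1)) * (r - s)"
      proof (rule T_diff_le[OF _ _ _ _ \<tau>1])
        fix y assume y: "y \<in> {s..r}"
        have "y powr (\<theta> + M - 1) * \<bar>\<psi> y\<bar> \<le> C * y powr (\<theta> + M - 1 + \<sigma>)"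
          by (rule weighted) (use y s r in auto)
        also have "\<dots> \<le> C * r powr (\<theta> + M - 1 + \<sigma>)"
          by (rule mult_left_mono[OF powr_mono2 C0]) (use y s \<sigma> \<theta>_pos M in auto)
        finally show "y powr (\<theta> + M - 1) * \<bar>\<psi> y\<bar> \<le> C * r powr (\<kappa> + \<sigma> + 1)"
          by (simp add: \<kappa>_def algebra_simps)
      qed (use s r in auto)
      also have "\<dots> \<le> A * (C * r powr (\<kappa> + \<sigma> + 1)) * r"
        by (rule mult_left_mono) (use s C0 A_nonneg in auto)
      also have "\<dots> = A * C * r powr (\<kappa> + \<sigma> + 2)"
        using powr_mult_base[of r "\<kappa> + \<sigma> + 1"] r by (simp add: algebra_simps)
      finally show ?thesis using s(3) by linarith
    qed
    then have "\<bar>T \<theta> r\<bar> \<le> A * C * r powr (\<kappa> + \<sigma> + 2)" by (rule field_le_epsilon)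
    moreover have "\<bar>T \<theta> r\<bar> = r powr \<kappa> * \<bar>r * \<psi>' r - \<theta> * \<psi> r\<bar>"
      using r by (simp add: T_\<theta>_eq abs_mult)
    moreover have "A * C * r powr (\<kappa> + \<sigma> + 2) = r powr \<kappa> * (A * C * r powr (\<sigma> + 2))"
      using powr_add[of r \<kappa> "\<sigma> + 2"] by (simp add: add.assoc)
    moreover have "0 < r powr \<kappa>" using r by simp
    ultimately have "\<bar>r * \<psi>' r - \<theta> * \<psi> r\<bar> \<le> A * C * r powr (\<sigma> + 2)"
      by (metis mult_le_cancel_left_pos)
    also have "\<dots> \<le> A * C * r powr \<rho>"
      by (rule mult_left_mono[OF powr_mono']) (use r C0 A_nonneg in \<open>auto simp: \<rho>_def\<close>)
    finally show ?thesis .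
  qed
  define E where "E = \<bar>T (- \<kappa>) 1\<bar> + A * C"
  have E: "\<bar>T (- \<kappa>) 1\<bar> \<le> E" "A * C \<le> E" using A_nonneg C0 by (auto simp: E_def)
  have h: "\<bar>r * \<psi>' r + \<kappa> * \<psi> r\<bar> \<le> E * r powr \<rho>" if r: "r \<in> {0<..1}" for r
  proof -
    \<comment> \<open>Since \<open>\<rho> \<le> \<theta>\<close>, this power is at least 1 and
      absorbs the boundary value at 1. This is why the exponent is capped at
      \<open>\<theta>\<close>.\<close>
    have one: "1 \<le> r powr (\<rho> - \<theta>)"
      using powr_mono'[of "\<rho> - \<theta>" 0 r] r by (simp add: \<rho>_def)
    have "\<bar>T (- \<kappa>) r\<bar> \<le> E * r powr (\<rho> - \<theta>)"
    proof (cases "r = 1")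
      case False
      have "\<bar>T (- \<kappa>) 1 - T (- \<kappa>) r\<bar> \<le> A * (C * r powr (\<rho> - \<theta>)) * (1 - r)"
      proof (rule T_diff_le[OF _ _ _ _ \<tau>2])
        fix y assume y: "y \<in> {r..1}"
        have "y powr (- \<kappa> + M - 1) * \<bar>\<psi> y\<bar> \<le> C * y powr (- \<kappa> + M - 1 + \<sigma>)"
          by (rule weighted) (use y r in auto)
        \<comment> \<open>The exponent equals \<open>\<sigma> + 1 - \<theta>\<close>, because
          \<open>- \<kappa> + M - 2 = - \<theta>\<close>, and
          \<open>\<rho> \<le> \<sigma> + 1\<close>.\<close>
        also have "\<dots> \<le> C * y powr (\<rho> - \<theta>)"
          by (rule mult_left_mono[OF powr_mono' C0]) (use y r in \<open>auto simp: \<rho>_def \<kappa>_def\<close>)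
        also have "\<dots> \<le> C * r powr (\<rho> - \<theta>)"
          by (rule mult_left_mono[OF powr_mono2' C0]) (use y r in \<open>auto simp: \<rho>_def\<close>)
        finally show "y powr (- \<kappa> + M - 1) * \<bar>\<psi> y\<bar> \<le> C * r powr (\<rho> - \<theta>)" .
      qed (use r False in auto)
      also have "\<dots> \<le> A * (C * r powr (\<rho> - \<theta>)) * 1"
        by (rule mult_left_mono) (use r C0 A_nonneg in auto)
      finally have 1: "\<bar>T (- \<kappa>) 1 - T (- \<kappa>) r\<bar> \<le> A * C * r powr (\<rho> - \<theta>)" by simp
      have 2: "\<bar>T (- \<kappa>) 1\<bar> \<le> \<bar>T (- \<kappa>) 1\<bar> * r powr (\<rho> - \<theta>)"
        using mult_left_mono[OF one, of "\<bar>T (- \<kappa>) 1\<bar>"] by simp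
      show ?thesis using 1 2 unfolding E_def distrib_right by linarith
    qed (use E in simp)
    then have "r powr (- \<theta>) * \<bar>r * \<psi>' r + \<kappa> * \<psi> r\<bar> \<le> r powr (- \<theta>) * (E * r powr \<rho>)"
      using r by (simp add: T_\<kappa>_eq abs_mult powr_diff powr_minus field_simps)
    then show ?thesis using r by simp
  qed
  have g': "\<bar>r * \<psi>' r - \<theta> * \<psi> r\<bar> \<le> E * r powr \<rho>" if r: "r \<in> {0<..1}" for r
    by (rule order_trans[OF g[OF r] mult_right_mono[OF E(2)]]) simp
  have pos: "0 < \<theta> + \<kappa>" using \<theta>_pos \<kappa>_pos by simp
  show thesis
  \<comment> \<open>Two linear equations are solved: \<open>?h - ?g\<close> isolates
    \<open>\<psi>\<close>, and \<open>\<theta> * ?h + \<kappa> * ?g\<close> isolates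
    \<open>r * \<psi>' r\<close>, each with factor \<open>\<theta> + \<kappa>\<close>. The maximum
    serves both bounds.\<close>
  proof (rule that[of "max (2 * E / (\<theta> + \<kappa>)) E"])
    fix r :: real assume r: "r \<in> {0<..1}"
    let ?g = "r * \<psi>' r - \<theta> * \<psi> r" and ?h = "r * \<psi>' r + \<kappa> * \<psi> r"
    have "?h - ?g = (\<theta> + \<kappa>) * \<psi> r" by (simp add: algebra_simps)
    then have "(\<theta> + \<kappa>) * \<bar>\<psi> r\<bar> = \<bar>?h - ?g\<bar>" using pos by (simp only: abs_mult)
    also have "\<dots> \<le> 2 * E * r powr \<rho>" using g'[OF r] h[OF r] by linarith
    finally have "\<bar>\<psi> r\<bar> \<le> 2 * E / (\<theta> + \<kappa>) * r powr \<rho>" using pos by (simp add: field_simps)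
    also have "\<dots> \<le> max (2 * E / (\<theta> + \<kappa>)) E * r powr \<rho>" by (rule mult_right_mono) auto
    finally show "\<bar>\<psi> r\<bar> \<le> max (2 * E / (\<theta> + \<kappa>)) E * r powr \<rho>" .
    have "(\<theta> + \<kappa>) * (r * \<psi>' r) = \<theta> * ?h + \<kappa> * ?g" by (simp add: algebra_simps)
    then have "(\<theta> + \<kappa>) * \<bar>r * \<psi>' r\<bar> = \<bar>\<theta> * ?h + \<kappa> * ?g\<bar>" using pos by (metis abs_mult abs_of_pos)
    also have "\<dots> \<le> \<theta> * \<bar>?h\<bar> + \<kappa> * \<bar>?g\<bar>"
      using \<theta>_pos \<kappa>_pos by (intro order_trans[OF abs_triangle_ineq]) (simp add: abs_mult)
    also have "\<dots> \<le> \<theta> * (E * r powr \<rho>) + \<kappa> * (E * r powr \<rho>)"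
      using \<theta>_pos \<kappa>_pos g'[OF r] h[OF r] by (intro add_mono mult_left_mono) auto
    also have "\<dots> = (\<theta> + \<kappa>) * (E * r powr \<rho>)" by (simp add: algebra_simps)
    finally have "\<bar>r * \<psi>' r\<bar> \<le> E * r powr \<rho>" using pos by simp
    also have "\<dots> \<le> max (2 * E / (\<theta> + \<kappa>)) E * r powr \<rho>" by (rule mult_right_mono) auto
    finally show "\<bar>r * \<psi>' r\<bar> \<le> max (2 * E / (\<theta> + \<kappa>)) E * r powr \<rho>" .
  qed
qed

lemma bootstrap_iterate:
  "\<exists>C. \<forall>r\<in>{0<..1}. \<bar>\<psi> r\<bar> \<le> C * r powr (min \<theta> (- (M - 2) / 2 + real n))"
proof (induction n)
  case 0
  have "min \<theta> (- (M - 2) / 2) = - (M - 2) / 2" using \<theta>_pos M by simp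
  moreover obtain C where "\<And>r. r \<in> {0<..1} \<Longrightarrow> \<bar>\<psi> r\<bar> \<le> C * r powr (- (M - 2) / 2)"
    using \<psi>_initial_bound by blast
  ultimately show ?case by (intro exI[of _ C]) simp
next
  case (Suc n)
  let ?\<sigma> = "min \<theta> (- (M - 2) / 2 + real n)"
  obtain C where "\<And>r. r \<in> {0<..1} \<Longrightarrow> \<bar>\<psi> r\<bar> \<le> C * r powr ?\<sigma>" using Suc.IH by blast
  moreover have "- (M - 2) / 2 \<le> ?\<sigma>" using \<theta>_pos M by simp
  \<comment> \<open>Capping before the step loses nothing, since \<open>\<theta> + 1\<close> lies
    above the cap.\<close>
  moreover have "min \<theta> (?\<sigma> + 1) = min \<theta> (- (M - 2) / 2 + real (Suc n))" by simp
  ultimately show ?case using bootstrap_step[of ?\<sigma> C] by metis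
qed

lemma decay:
  obtains C where "\<And>r. r \<in> {0<..1} \<Longrightarrow> \<bar>\<psi> r\<bar> \<le> C * r powr \<theta>"
    "\<And>r. r \<in> {0<..1} \<Longrightarrow> \<bar>\<psi>' r\<bar> \<le> C * r powr (\<theta> - 1)"
proof -
  obtain n :: nat where "\<theta> + (M - 2) / 2 < real n" using reals_Archimedean2 by blast
  then have min: "min \<theta> (- (M - 2) / 2 + real n) = \<theta>" by (simp add: field_simps)
  obtain C where "\<And>r. r \<in> {0<..1} \<Longrightarrow> \<bar>\<psi> r\<bar> \<le> C * r powr \<theta>"
    using bootstrap_iterate[of n] unfolding min by blast
  moreover have "- (M - 2) / 2 \<le> \<theta>" using \<theta>_pos M by simp
  \<comment> \<open>One more step from \<open>\<sigma> = \<theta>\<close> leaves the exponent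
    unchanged; it is taken for the bound on \<open>r * \<psi>' r\<close>.\<close>
  ultimately obtain D where D: "\<And>r. r \<in> {0<..1} \<Longrightarrow> \<bar>\<psi> r\<bar> \<le> D * r powr \<theta>"
    "\<And>r. r \<in> {0<..1} \<Longrightarrow> \<bar>r * \<psi>' r\<bar> \<le> D * r powr \<theta>"
    using bootstrap_step[of \<theta> C] by (auto simp: min_def)
  have "\<bar>\<psi>' r\<bar> \<le> D * r powr (\<theta> - 1)" if "r \<in> {0<..1}" for r
    using D(2)[OF that] that by (simp add: abs_mult powr_diff field_simps)
  with D(1) show thesis by (rule that)
qed

end

section \<open>Continuity at the origin and the asymptotic bounds\<close>

theorem proposition3p8:
  fixes M \<nu> \<theta> :: real and a \<psi> :: "real \<Rightarrow> real"
  assumes "M \<ge> 2"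
    and "a \<in> Linfinity"
    and "\<nu> < 0"
    and "weak_solution M a \<nu> \<psi>"
    and "\<theta> = (2 - M + sqrt ((M - 2)\<^sup>2 - 4 * \<nu>)) / 2"
  shows "(\<exists>g. continuous_on {0..1} g \<and> (\<forall>r\<in>{0<..1}. g r = \<psi> r)) \<and>
    \<psi> \<in> O[at_right 0](\<lambda>r. r powr \<theta>) \<and>
    (\<exists>\<psi>'. (\<forall>r\<in>{0<..1}. (\<psi> has_real_derivative \<psi>' r) (at r within {0<..1})) \<and>
       continuous_on {0<..1} \<psi>' \<and>
       \<psi>' \<in> O[at_right 0](\<lambda>r. r powr (\<theta> - 1)))"
proof -
  obtain b A \<psi>' K where b: "\<And>r. \<bar>b r\<bar> \<le> A"
    and \<psi>': "\<And>r. r \<in> {0<..1} \<Longrightarrow> (\<psi> has_real_derivative \<psi>' r) (at r within {0<..1})" "continuous_on {0<..1} \<psi>'"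
    and rest: "\<And>s. 0 < s \<Longrightarrow> s < 1 \<Longrightarrow> has_ac_derivative (\<lambda>r. r powr (M - 1) * \<psi>' r)
        (\<lambda>r. - (r powr (M - 1) * (b r * \<psi> r) + \<nu> * (r powr (M - 3) * \<psi> r))) s 1"
      "\<And>s. 0 < s \<Longrightarrow> s < 1 \<Longrightarrow> integral {s..1} (\<lambda>r. r powr (M - 1) * (\<psi>' r)\<^sup>2 + r powr (M - 3) * (\<psi> r)\<^sup>2) \<le> K"
    by (rule weak_solution_C1[OF assms(4,2)]) blast
  interpret R: radial_solution M \<nu> A K b \<psi> \<psi>'
    by unfold_locales (use assms(1,3) b \<psi>' rest in auto)
  have \<theta>: "R.\<theta> = \<theta>" using assms(5) by (simp add: R.\<theta>_def)
  have \<theta>_pos: "0 < \<theta>" using R.\<theta>_pos \<theta> by simp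
  obtain C where C: "\<And>r. r \<in> {0<..1} \<Longrightarrow> \<bar>\<psi> r\<bar> \<le> C * r powr \<theta>"
    "\<And>r. r \<in> {0<..1} \<Longrightarrow> \<bar>\<psi>' r\<bar> \<le> C * r powr (\<theta> - 1)"
    using R.decay unfolding \<theta> by blast
  \<comment> \<open>The value \<open>\<psi> 0\<close> is arbitrary, so continuity on the closed
    interval concerns the extension by the limit 0, which exists because
    \<open>\<theta> > 0\<close>.\<close>
  define g where "g = (\<lambda>r. if r = 0 then 0 else \<psi> r)"
  have "continuous (at r within {0..1}) g" if r: "r \<in> {0..1}" for r
  proof (cases "r = 0")
    case True
    have "((\<lambda>r. C * r powr \<theta>) \<longlongrightarrow> C * 0) (at_right 0)"
      by (intro tendsto_mult tendsto_const tendsto_powr'[where a = "0::real" and b = \<theta>, simplified] tendsto_intros)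
         (use \<theta>_pos in \<open>auto simp: eventually_at_filter\<close>)
    then have "(g \<longlongrightarrow> 0) (at_right 0)"
      by (intro Lim_null_comparison[of g "\<lambda>r. C * r powr \<theta>"] eventually_at_rightI[of 0 1])
         (use C in \<open>auto simp: g_def\<close>)
    moreover have "at_right 0 = at (0::real) within {0..1}"
      using at_within_Icc_at_right[of 0 "1::real"] by simp
    ultimately show ?thesis using True by (simp add: continuous_within g_def)
  next
    case False
    have "continuous_on {0<..1} g"
      by (rule continuous_on_eq[OF R.cont_\<psi>]) (simp add: g_def)
    then have "continuous (at r within {0<..1}) g"
      using r False by (auto simp: continuous_on_eq_continuous_within)
    moreover have "at r within {0..1} = at r within {0<..1}"
      by (rule at_within_nhd[of _ "{0<..}"]) (use r False in auto)
    ultimately show ?thesis by (simp add: continuous_within)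
  qed
  then have "continuous_on {0..1} g" by (simp add: continuous_on_eq_continuous_within)
  moreover have "\<forall>r\<in>{0<..1}. g r = \<psi> r" by (simp add: g_def)
  moreover have "\<psi> \<in> O[at_right 0](\<lambda>r. r powr \<theta>)"
    by (intro bigoI[of _ C] eventually_at_rightI[of 0 1]) (use C(1) in auto)
  moreover have "\<psi>' \<in> O[at_right 0](\<lambda>r. r powr (\<theta> - 1))"
    by (intro bigoI[of _ C] eventually_at_rightI[of 0 1]) (use C(2) in auto)
  ultimately show ?thesis using \<psi>' by blast
qed

end
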